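(* For every $\varepsilon>0$ there exists $C>1$ such that the following holds. Let $\Delta=\Delta(n)$ be an integer with $\Delta\ge Cn/\log n$, and suppose that $k=\lceil (n-1)/\Delta\rceil-1\ge 2$. Then, with high probability, the random graph $G(n,1-n^{-(1+2\varepsilon)/k})$ contains every tree in $\mathcal{T}(n,\Delta)$ (simultaneously).
   Context: Graphs are finite and simple; $\log$ is the natural logarithm. $\mathcal{T}(n,\Delta)$ denotes the set of all $n$-vertex trees with maximum degree at most $\Delta$. A graph $G$ contains a tree $T$ if $G$ has a (not necessarily induced) subgraph isomorphic to $T$. $G(n,p)$ is the binomial random graph on $n$ labelled vertices in which every pair is an edge independently with probability $p$. "With high probability" means with probability tending to $1$ as $n\to\infty$; here $\Delta$ (and hence $k$) may depend on $n$. *)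

theory Defs
  imports "HOL-Probability.Probability"
begin

text \<open>An undirected graph is a pair of a vertex set and a set of two-element sets of vertices.\<close>

type_synonym 'a graph = "'a set \<times> 'a set set"

abbreviation verts :: "'a graph \<Rightarrow> 'a set" where "verts G \<equiv> fst G"
abbreviation edges :: "'a graph \<Rightarrow> 'a set set" where "edges G \<equiv> snd G"

definition all_pairs :: "'a set \<Rightarrow> 'a set set" where
  "all_pairs V = {e. e \<subseteq> V \<and> card e = 2}"

definition simple_graph :: "'a graph \<Rightarrow> bool" where
  "simple_graph G \<longleftrightarrow> finite (verts G) \<and> edges G \<subseteq> all_pairs (verts G)"

definition degree :: "'a graph \<Rightarrow> 'a \<Rightarrow> nat" where
  "degree G v = card {e \<in> edges G. v \<in> e}"

definition walk :: "'a graph \<Rightarrow> 'a list \<Rightarrow> bool" where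
  "walk G xs \<longleftrightarrow> xs \<noteq> [] \<and> set xs \<subseteq> verts G \<and>
     (\<forall>i. Suc i < length xs \<longrightarrow> {xs ! i, xs ! Suc i} \<in> edges G)"

definition connected_graph :: "'a graph \<Rightarrow> bool" where
  "connected_graph G \<longleftrightarrow> verts G \<noteq> {} \<and>
     (\<forall>u \<in> verts G. \<forall>v \<in> verts G. \<exists>xs. walk G xs \<and> hd xs = u \<and> last xs = v)"

text \<open>A cycle is listed without repeating its first vertex at the end.\<close>

definition graph_cycle :: "'a graph \<Rightarrow> 'a list \<Rightarrow> bool" where
  "graph_cycle G xs \<longleftrightarrow>
     walk G xs \<and> distinct xs \<and> length xs \<ge> 3 \<and> {last xs, hd xs} \<in> edges G"

definition tree_graph :: "'a graph \<Rightarrow> bool" where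
  "tree_graph G \<longleftrightarrow> simple_graph G \<and> connected_graph G \<and> (\<nexists>xs. graph_cycle G xs)"

text \<open>Vertices are taken from \<^typ>\<open>nat\<close>, but the vertex set is an arbitrary \<open>n\<close>-element set;
  every finite graph is isomorphic to one of this kind.\<close>

definition bounded_degree_trees :: "nat \<Rightarrow> nat \<Rightarrow> nat graph set" where
  "bounded_degree_trees n \<Delta> = {T. tree_graph T \<and> card (verts T) = n \<and> (\<forall>v \<in> verts T. degree T v \<le> \<Delta>)}"

definition subgraph :: "'a graph \<Rightarrow> 'a graph \<Rightarrow> bool" where
  "subgraph H G \<longleftrightarrow> simple_graph H \<and> verts H \<subseteq> verts G \<and> edges H \<subseteq> edges G"

definition graph_iso :: "'a graph \<Rightarrow> 'b graph \<Rightarrow> bool" where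
  "graph_iso G H \<longleftrightarrow> (\<exists>f. bij_betw f (verts G) (verts H) \<and>
     (\<forall>u \<in> verts G. \<forall>v \<in> verts G. {u, v} \<in> edges G \<longleftrightarrow> {f u, f v} \<in> edges H))"

definition contains :: "'a graph \<Rightarrow> 'b graph \<Rightarrow> bool" where
  "contains G T \<longleftrightarrow> (\<exists>H. subgraph H G \<and> graph_iso H T)"

definition random_graph :: "nat \<Rightarrow> real \<Rightarrow> nat graph pmf" where
  "random_graph n p =
     map_pmf (\<lambda>\<omega>. ({..<n}, {e \<in> all_pairs {..<n}. \<omega> e}))
       (Pi_pmf (all_pairs {..<n}) False (\<lambda>_. bernoulli_pmf p))"

end

theory Submission
  imports Defs "HOL-Real_Asymp.Real_Asymp"
begin

text \<open>
  Let \<open>\<eta> = min \<epsilon> (1/2)\<close> and \<open>d = n powr (-(1 + \<eta>) / k)\<close>. A union bound over sets of non-neighbours shows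
  that with high probability every vertex of the random graph has at most \<open>d n\<close> non-neighbours, and
  every graph with this property contains all the trees.

  To embed a tree \<open>T\<close>, choose a large independent set \<open>I\<close> of vertices of bounded degree. Embed \<open>T - I\<close>
  vertex by vertex at random; since \<open>I\<close> is large, each image lies in a given set of \<open>d n\<close> vertices with
  probability \<open>O(d)\<close>. If \<open>T\<close> consists almost entirely of leaves, \<open>I\<close> is the set of leaves. A target vertex
  \<open>x\<close> is in danger only if it is not adjacent to the images of vertices carrying at least
  \<open>(1 - O(\<eta>)) n \<ge> (1 - O(\<eta>)) k \<Delta>\<close> leaves; as a vertex carries at most \<open>\<Delta>\<close> leaves, this has probability about
  \<open>d powr k = n powr (-(1 + \<eta>))\<close>, up to a factor that is a small power of \<open>n\<close> because \<open>k \<le> ln n / C\<close>.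
  Otherwise there are linearly many vertices of bounded degree without a neighbour of degree above
  \<open>\<beta> n / ln n\<close>, \<open>\<beta>\<close> a small constant, from which \<open>I\<close> is taken, and ordinary exponential concentration suffices. In both
  cases the remaining bipartite graph between \<open>I\<close> and the unused vertices has a perfect matching.
\<close>

subsection \<open>Trees\<close>

text \<open>Degrees are handled as cardinalities of neighbourhoods, so that degrees into a subset
  \<open>U\<close> become \<open>card (nbhd T v \<inter> U)\<close>.\<close>

definition nbhd :: "'a graph \<Rightarrow> 'a \<Rightarrow> 'a set" where
  "nbhd T v = {u \<in> verts T. {u, v} \<in> edges T}"

lemma simple_graph_irrefl: "simple_graph T \<Longrightarrow> {v, v} \<notin> edges T"
  by (auto simp: simple_graph_def all_pairs_def)

lemma simple_graph_edgeD:
  "simple_graph T \<Longrightarrow> {u, v} \<in> edges T \<Longrightarrow> u \<in> verts T \<and> v \<in> verts T \<and> u \<noteq> v"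
  by (auto simp: simple_graph_def all_pairs_def)

lemma finite_nbhd: "simple_graph T \<Longrightarrow> finite (nbhd T v)"
  by (simp add: nbhd_def simple_graph_def)

lemma nbhd_sym: "simple_graph T \<Longrightarrow> u \<in> nbhd T v \<longleftrightarrow> v \<in> nbhd T u"
  by (auto simp: nbhd_def insert_commute dest: simple_graph_edgeD)

lemma degree_eq_card_nbhd:
  assumes "simple_graph T"
  shows "degree T v = card (nbhd T v)"
proof -
  have "bij_betw (\<lambda>u. {u, v}) (nbhd T v) {e \<in> edges T. v \<in> e}"
  proof (rule bij_betwI')
    show "({x, v} = {y, v}) = (x = y)" for x y
      by (auto simp: doubleton_eq_iff)
    show "{x, v} \<in> {e \<in> edges T. v \<in> e}" if "x \<in> nbhd T v" for x
      using that by (auto simp: nbhd_def)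
    show "\<exists>x\<in>nbhd T v. e = {x, v}" if "e \<in> {e \<in> edges T. v \<in> e}" for e
    proof -
      have e: "e \<in> edges T" "v \<in> e" "card e = 2" "e \<subseteq> verts T"
        using that assms by (auto simp: simple_graph_def all_pairs_def)
      then obtain x where "e = {x, v}"
        by (auto simp: card_2_iff)
      then show ?thesis using e by (auto simp: nbhd_def)
    qed
  qed
  then show ?thesis by (simp add: degree_def bij_betw_same_card)
qed

text \<open>A longest path inside \<open>U\<close> starts at such a vertex: by maximality its
  neighbours in \<open>U\<close> all lie on the path, and one other than the second vertex would
  close a cycle. Removing such vertices one by one drives the inductions on forests below.\<close>

lemma acyclic_low_degree_vertex:
  assumes T: "simple_graph T" and ac: "\<nexists>xs. graph_cycle T xs"
    and U: "U \<subseteq> verts T" "U \<noteq> {}"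
  shows "\<exists>v \<in> U. card (nbhd T v \<inter> U) \<le> 1"
proof (rule ccontr)
  assume neg: "\<not> ?thesis"
  have finU: "finite U" using T U finite_subset by (auto simp: simple_graph_def)
  define P where "P xs \<longleftrightarrow> walk T xs \<and> distinct xs \<and> set xs \<subseteq> U" for xs
  obtain u0 where "u0 \<in> U" using U by blast
  then have "P [u0]" using U by (auto simp: P_def walk_def)
  moreover have "length xs < Suc (card U)" if "P xs" for xs
    using that finU by (metis P_def card_mono distinct_card le_imp_less_Suc)
  ultimately obtain xs where xs: "P xs" and mx: "\<And>ys. P ys \<Longrightarrow> length ys \<le> length xs"
    using ex_has_greatest_nat[of P "[u0]" length "Suc (card U)"] by blast
  define v where "v = hd xs"
  have ne: "xs \<noteq> []" and wk: "walk T xs" and dist: "distinct xs" and sub: "set xs \<subseteq> U"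
    using xs by (auto simp: P_def walk_def)
  have v: "v \<in> U" "xs ! 0 = v" using ne sub by (auto simp: v_def hd_conv_nth)
  have inxs: "u \<in> set xs" if u: "u \<in> nbhd T v \<inter> U" for u
  proof (rule ccontr)
    assume "u \<notin> set xs"
    moreover have "walk T (u # xs)"
      using wk u v U by (auto simp: walk_def nbhd_def nth_Cons split: nat.splits)
    ultimately have "P (u # xs)" using dist sub u by (auto simp: P_def)
    from mx[OF this] show False by simp
  qed
  have "card (nbhd T v \<inter> U) > card {xs ! 1}" using neg v by force
  then have "\<not> nbhd T v \<inter> U \<subseteq> {xs ! 1}"
    by (metis card_mono finite.emptyI finite_insert not_le)
  then obtain u where u: "u \<in> nbhd T v \<inter> U" "u \<noteq> xs ! 1" by blast
  obtain i where i: "i < length xs" "xs ! i = u" using inxs[OF u(1)] by (auto simp: in_set_conv_nth)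
  have "u \<noteq> v" using u T by (auto simp: nbhd_def dest: simple_graph_edgeD)
  then have "i \<noteq> 0" using v(2) i by metis
  moreover have "i \<noteq> 1" using u i by auto
  ultimately have i2: "i \<ge> 2" by simp
  \<comment> \<open>The cycle is the initial segment of the path up to \<open>u\<close>;
    \<open>i \<ge> 2\<close> gives it length at least 3.\<close>
  have "graph_cycle T (take (Suc i) xs)"
    unfolding graph_cycle_def
  proof (intro conjI)
    show "walk T (take (Suc i) xs)"
      using wk ne by (auto simp: walk_def dest: in_set_takeD)
    show "distinct (take (Suc i) xs)" using dist by simp
    show "3 \<le> length (take (Suc i) xs)" using i i2 by simp
    have "last (take (Suc i) xs) = u" using i by (simp add: take_Suc_conv_app_nth)
    moreover have "hd (take (Suc i) xs) = v" using ne by (simp add: v_def)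
    ultimately show "{last (take (Suc i) xs), hd (take (Suc i) xs)} \<in> edges T"
      using u by (simp add: nbhd_def)
  qed
  with ac show False by blast
qed

text \<open>Induction by deleting a vertex of degree at most one inside \<open>U\<close>: this
  lowers the sum by twice that degree, hence by at most 2.\<close>

lemma acyclic_degree_sum:
  assumes T: "simple_graph T" and ac: "\<nexists>xs. graph_cycle T xs" and "U \<subseteq> verts T"
  shows "(\<Sum>v\<in>U. card (nbhd T v \<inter> U)) \<le> 2 * card U"
  using \<open>U \<subseteq> verts T\<close>
proof (induction "card U" arbitrary: U)
  case 0
  have "finite U" using T 0 finite_subset[of U "verts T"] by (auto simp: simple_graph_def)
  then show ?case using 0 by simp
next
  case (Suc k)
  have finU: "finite U" using T Suc finite_subset by (auto simp: simple_graph_def)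
  have "U \<noteq> {}" using Suc by auto
  then obtain v where v: "v \<in> U" "card (nbhd T v \<inter> U) \<le> 1"
    using acyclic_low_degree_vertex[OF T ac] Suc.prems by blast
  let ?U = "U - {v}"
  have cU: "card ?U = k" using v Suc by simp
  have IH: "(\<Sum>u\<in>?U. card (nbhd T u \<inter> ?U)) \<le> 2 * k"
    using Suc.hyps(1)[of ?U] cU Suc.prems by auto
  have "card (nbhd T u \<inter> U) = card (nbhd T u \<inter> ?U) + (if u \<in> nbhd T v then 1 else 0)"
    if "u \<in> ?U" for u
  proof (cases "u \<in> nbhd T v")
    case True
    then have "nbhd T u \<inter> U = insert v (nbhd T u \<inter> ?U)" using v nbhd_sym[OF T] by auto
    then show ?thesis using True finU by simp
  next
    case False
    then have "nbhd T u \<inter> U = nbhd T u \<inter> ?U" using v nbhd_sym[OF T] by auto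
    then show ?thesis using False by simp
  qed
  then have "(\<Sum>u\<in>?U. card (nbhd T u \<inter> U)) =
      (\<Sum>u\<in>?U. card (nbhd T u \<inter> ?U)) + (\<Sum>u\<in>?U. if u \<in> nbhd T v then 1 else 0)"
    by (simp add: sum.distrib)
  also have "(\<Sum>u\<in>?U. if u \<in> nbhd T v then 1 else 0) = card (nbhd T v \<inter> ?U)"
    using finU by (simp add: sum.If_cases Int_commute Int_def)
  also have "\<dots> \<le> card (nbhd T v \<inter> U)"
    using finU by (intro card_mono) auto
  finally have "(\<Sum>u\<in>?U. card (nbhd T u \<inter> U)) \<le> 2 * k + 1" using IH v by linarith
  then show ?case using v finU Suc.hyps(2) sum.remove[OF finU v(1), of "\<lambda>u. card (nbhd T u \<inter> U)"]
    by simp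
qed

section \<open>Leaves in connected graphs\<close>

lemma connected_nbhd_nonempty:
  assumes T: "simple_graph T" "connected_graph T" and v: "v \<in> verts T" and "card (verts T) \<ge> 2"
  shows "nbhd T v \<noteq> {}"
proof -
  have "\<not> verts T \<subseteq> {v}"
    using assms(4) card_mono[of "{v}" "verts T"] by auto
  then obtain u where u: "u \<in> verts T" "u \<noteq> v" by blast
  then obtain xs where xs: "walk T xs" "hd xs = v" "last xs = u"
    using T v unfolding connected_graph_def by blast
  then have l: "Suc 0 < length xs" using u by (cases xs; cases "tl xs") (auto simp: walk_def)
  then have "{xs ! 0, xs ! Suc 0} \<in> edges T" "xs ! 0 = v" 
    using xs by (auto simp: walk_def hd_conv_nth)
  then have "{xs ! 1, v} \<in> edges T" by (simp add: insert_commute)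
  then show ?thesis using T simple_graph_edgeD[of T "xs ! 1" v] by (auto simp: nbhd_def)
qed

text \<open>Two adjacent leaves would form a component of their own, so no walk from
  \<open>u\<close> could reach a third vertex.\<close>

lemma leaves_not_adjacent:
  assumes T: "simple_graph T" "connected_graph T" and n: "card (verts T) \<ge> 3"
    and l: "card (nbhd T u) \<le> 1" "card (nbhd T v) \<le> 1" 
  shows "{u, v} \<notin> edges T"
proof
  assume e: "{u, v} \<in> edges T"
  have uv: "u \<in> verts T" "v \<in> verts T" using simple_graph_edgeD[OF T(1) e] by auto
  have "u \<in> nbhd T v" "v \<in> nbhd T u" using e uv by (auto simp: nbhd_def insert_commute)
  then have nbhd: "nbhd T v = {u}" "nbhd T u = {v}"
    using l finite_nbhd[OF T(1)] by (metis card_1_singletonE card_le_Suc0_iff_eq One_nat_def is_singletonI' is_singleton_def singletonD empty_iff)+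
  have "\<not> verts T \<subseteq> {u, v}"
    using n card_mono[of "{u, v}" "verts T"] by (auto simp: card_insert_if split: if_splits)
  then obtain x where x: "x \<in> verts T" "x \<noteq> u" "x \<noteq> v" by blast
  then obtain xs where xs: "walk T xs" "hd xs = u" "last xs = x"
    using T uv unfolding connected_graph_def by blast
  have "i < length xs \<Longrightarrow> xs ! i \<in> {u, v}" for i
  proof (induction i)
    case 0
    then show ?case using xs by (auto simp: hd_conv_nth)
  next
    case (Suc i)
    then have "{xs ! Suc i, xs ! i} \<in> edges T" using xs by (auto simp: walk_def insert_commute)
    then have "xs ! Suc i \<in> nbhd T (xs ! i)" using simple_graph_edgeD[OF T(1)] by (auto simp: nbhd_def)
    then show ?case using Suc nbhd by auto
  qed
  then have "last xs \<in> {u, v}" using xs(1) by (auto simp: last_conv_nth walk_def simp del: insert_iff)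
  then show False using x xs by auto
qed

text \<open>The required subgraph \<open>H\<close> is the image of \<open>T\<close>, and the
  isomorphism from \<open>H\<close> to \<open>T\<close> is the inverse of
  \<open>\<phi>\<close>.\<close>

lemma contains_if_embedding:
  assumes T: "simple_graph T" and G: "finite (verts G)"
    and b: "bij_betw \<phi> (verts T) (verts G)"
    and e: "\<And>u v. {u, v} \<in> edges T \<Longrightarrow> {\<phi> u, \<phi> v} \<in> edges G"
  shows "contains G T"
proof -
  define H where "H = (verts G, (`) \<phi> ` edges T)"
  define f where "f = inv_into (verts T) \<phi>"
  have inj: "inj_on \<phi> (verts T)" and im: "\<phi> ` verts T = verts G" using b by (auto simp: bij_betw_def)
  have ed: "a \<subseteq> verts T \<and> card a = 2" if "a \<in> edges T" for a
    using that T by (auto simp: simple_graph_def all_pairs_def)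
  have "subgraph H G"
    unfolding subgraph_def simple_graph_def
  proof (intro conjI)
    show "finite (verts H)" using G by (simp add: H_def)
    have "card (\<phi> ` a) = 2 \<and> \<phi> ` a \<subseteq> verts G" if "a \<in> edges T" for a
      using ed[OF that] inj im by (metis card_image image_mono inj_on_subset)
    then show "edges H \<subseteq> all_pairs (verts H)" by (auto simp: H_def all_pairs_def)
    show "verts H \<subseteq> verts G" by (simp add: H_def)
    have "\<phi> ` a \<in> edges G" if "a \<in> edges T" for a
    proof -
      have "card a = 2" using ed that by blast
      then obtain u v where "a = {u, v}" by (auto simp: card_2_iff)
      then show ?thesis using e that by auto
    qed
    then show "edges H \<subseteq> edges G" by (auto simp: H_def)
  qed
  moreover have "graph_iso H T"
    unfolding graph_iso_def
  proof (intro exI[of _ f] conjI ballI)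
    show "bij_betw f (verts H) (verts T)" using b by (simp add: f_def H_def bij_betw_inv_into)
    fix u v assume "u \<in> verts H" "v \<in> verts H"
    then have uv: "u \<in> verts G" "v \<in> verts G" by (auto simp: H_def)
    have img: "\<phi> ` f ` {u, v} = {u, v}"
      using uv im by (auto simp: f_def f_inv_into_f)
    have forth: "f ` \<phi> ` a = a" if "a \<in> edges T" for a
      using ed[OF that] inj by (force simp: f_def image_image inv_into_f_f subset_iff)
    show "({u, v} \<in> edges H) = ({f u, f v} \<in> edges T)"
    proof
      assume "{u, v} \<in> edges H"
      then obtain a where "a \<in> edges T" "{u, v} = \<phi> ` a" by (auto simp: H_def)
      then have "f ` {u, v} = a" using forth by simp
      then show "{f u, f v} \<in> edges T" using \<open>a \<in> edges T\<close> by auto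
    next
      assume "{f u, f v} \<in> edges T"
      then have "f ` {u, v} \<in> edges T" by simp
      then have "\<phi> ` f ` {u, v} \<in> edges H" unfolding H_def by (metis imageI snd_conv)
      then show "{u, v} \<in> edges H" using img by simp
    qed
  qed
  ultimately show ?thesis unfolding contains_def by blast
qed

subsection \<open>Embedding around an independent set\<close>

text \<open>Since edges have two elements, \<open>{y \<in> verts G. {x, y} \<notin> edges G}\<close> includes \<open>x\<close> itself.
  The number \<open>\<Sum>v\<in>U. w v * of_bool ({x, \<phi> v} \<notin> edges G)\<close> is the weight that is lost at
  the target vertex \<open>x\<close>. The exponential potential is a pessimistic estimator: choosing the image of
  the next vertex by averaging replaces the random choice.\<close>

lemma greedy_embedding:
  fixes T :: "'a graph" and G :: "'b graph" and w :: "'a \<Rightarrow> real" and D s \<mu> :: real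
  assumes T: "simple_graph T" and ac: "\<nexists>xs. graph_cycle T xs" and U: "U \<subseteq> verts T"
    and G: "finite (verts G)"
    and D: "\<And>x. x \<in> verts G \<Longrightarrow> real (card {y \<in> verts G. {x, y} \<notin> edges G}) \<le> D"
    and D0: "D \<ge> 0" and s: "s > 0" "real (card U) + D + s \<le> real (card (verts G))"
    and w: "\<And>v. v \<in> U \<Longrightarrow> w v \<ge> 0" and \<mu>: "\<mu> \<ge> 0"
  shows "\<exists>\<phi>. inj_on \<phi> U \<and> \<phi> ` U \<subseteq> verts G \<and>
    (\<forall>u\<in>U. \<forall>v\<in>U. {u, v} \<in> edges T \<longrightarrow> {\<phi> u, \<phi> v} \<in> edges G) \<and>
    (\<Sum>x\<in>verts G. exp (\<mu> * (\<Sum>v\<in>U. w v * of_bool ({x, \<phi> v} \<notin> edges G))))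
      \<le> real (card (verts G)) * (\<Prod>v\<in>U. 1 + D / s * (exp (\<mu> * w v) - 1))"
  using U s(2) w
proof (induction "card U" arbitrary: U)
  case 0
  have "finite U" using T 0(2) finite_subset[of U "verts T"] by (auto simp: simple_graph_def)
  then have "U = {}" using 0 by simp
  then show ?case by simp
next
  case (Suc k)
  let ?V = "verts G"
  have finU: "finite U" using T Suc finite_subset[of U "verts T"] by (auto simp: simple_graph_def)
  have "U \<noteq> {}" using Suc by auto
  \<comment> \<open>This \<open>v\<close> is embedded last. It has at most one neighbour embedded
    before it, so adjacency forbids at most \<open>D\<close> targets.\<close>
  then obtain v where v: "v \<in> U" "card (nbhd T v \<inter> U) \<le> 1"
    using acyclic_low_degree_vertex[OF T ac] Suc.prems by blast
  define U' where "U' = U - {v}"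
  have U': "U = insert v U'" "v \<notin> U'" "finite U'" using v finU by (auto simp: U'_def)
  have cU: "card U' = k" using U' Suc by simp
  obtain \<phi> where inj: "inj_on \<phi> U'" and im: "\<phi> ` U' \<subseteq> ?V"
    and ed: "\<And>u v. u \<in> U' \<Longrightarrow> v \<in> U' \<Longrightarrow> {u, v} \<in> edges T \<Longrightarrow> {\<phi> u, \<phi> v} \<in> edges G"
    and pot: "(\<Sum>x\<in>?V. exp (\<mu> * (\<Sum>v\<in>U'. w v * of_bool ({x, \<phi> v} \<notin> edges G))))
      \<le> real (card ?V) * (\<Prod>v\<in>U'. 1 + D / s * (exp (\<mu> * w v) - 1))"
    using Suc.hyps(1)[of U'] cU Suc.prems U' by (auto)
  define p where "p x = exp (\<mu> * (\<Sum>v\<in>U'. w v * of_bool ({x, \<phi> v} \<notin> edges G)))" for x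
  define B where "B = {y \<in> ?V. \<exists>u \<in> nbhd T v \<inter> U'. {\<phi> u, y} \<notin> edges G}"
  \<comment> \<open>The admissible images of \<open>v\<close>; the slack in the size hypothesis
    leaves at least \<open>s\<close> of them.\<close>
  define A where "A = ?V - \<phi> ` U' - B"
  have "nbhd T v \<inter> U = nbhd T v \<inter> U'" using U' T by (auto simp: nbhd_def dest: simple_graph_irrefl)
  then have nb1: "card (nbhd T v \<inter> U') \<le> 1" using v by simp
  have cB: "real (card B) \<le> D"
  proof (cases "nbhd T v \<inter> U' = {}")
    case True
    then show ?thesis using D0 by (simp add: B_def)
  next
    case False
    then obtain u where u: "nbhd T v \<inter> U' = {u}"
      using nb1 finite_nbhd[OF T] by (metis One_nat_def card_le_Suc0_iff_eq finite_Int is_singletonI' is_singleton_def)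
    then have "\<phi> u \<in> ?V" using im by auto
    from D[OF this] show ?thesis by (simp add: B_def u)
  qed
  have finA: "finite A" using G by (simp add: A_def)
  have "card ?V \<le> card (A \<union> (\<phi> ` U' \<union> B))" using G finA U' B_def by (intro card_mono) (auto simp: A_def)
  also have "\<dots> \<le> card A + (card (\<phi> ` U') + card B)"
    by (meson card_Un_le order_trans add_left_mono)
  also have "card (\<phi> ` U') = k" using inj cU by (simp add: card_image)
  finally have cA: "real (card A) \<ge> s"
    using Suc.prems(2) Suc.hyps(2) cB by linarith
  let ?e = "exp (\<mu> * w v) - 1"
  have e0: "?e \<ge> 0" using Suc.prems(3) v \<mu> by simp
  \<comment> \<open>\<open>q y\<close> is the potential after mapping \<open>v\<close> to
    \<open>y\<close>: the term of \<open>x\<close> gains the factor \<open>exp (\<mu> * w v)\<close>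
    exactly when \<open>{x, y}\<close> is not an edge. For fixed \<open>x\<close> this concerns at
    most \<open>D\<close> choices of \<open>y\<close>, which bounds the average of \<open>q\<close>
    over \<open>A\<close>.\<close>
  define q where "q y = (\<Sum>x\<in>?V. p x * (1 + of_bool ({x, y} \<notin> edges G) * ?e))" for y
  have "(\<Sum>y\<in>A. q y) = (\<Sum>x\<in>?V. p x * (\<Sum>y\<in>A. 1 + of_bool ({x, y} \<notin> edges G) * ?e))"
    unfolding q_def sum_distrib_left by (rule sum.swap)
  also have "\<dots> \<le> (\<Sum>x\<in>?V. p x * (card A + D * ?e))"
  proof (intro sum_mono mult_left_mono)
    fix x assume x: "x \<in> ?V"
    have "(\<Sum>y\<in>A. of_bool ({x, y} \<notin> edges G) :: real) = card {y \<in> A. {x, y} \<notin> edges G}"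
      using finA by (simp add: of_bool_def sum.If_cases Int_def)
    also have "\<dots> \<le> card {y \<in> ?V. {x, y} \<notin> edges G}"
      using G by (intro of_nat_mono card_mono) (auto simp: A_def)
    finally have "(\<Sum>y\<in>A. of_bool ({x, y} \<notin> edges G) :: real) \<le> D" using D[OF x] by linarith
    then have "(\<Sum>y\<in>A. of_bool ({x, y} \<notin> edges G)) * ?e \<le> D * ?e" using e0 by (rule mult_right_mono)
    then show "(\<Sum>y\<in>A. 1 + of_bool ({x, y} \<notin> edges G) * ?e) \<le> card A + D * ?e"
      by (simp add: sum.distrib sum_distrib_right)
  qed (simp add: p_def)
  also have "\<dots> = card A * ((\<Sum>x\<in>?V. p x) * (1 + D / card A * ?e))"
  proof -
    have "card A + D * ?e = card A * (1 + D / card A * ?e)"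
      using cA s by (simp add: field_simps)
    then show ?thesis unfolding sum_distrib_right[symmetric] by simp
  qed
  also have "\<dots> \<le> card A * ((\<Sum>x\<in>?V. p x) * (1 + D / s * ?e))"
    using cA s D0 e0
    by (intro mult_left_mono add_left_mono mult_right_mono divide_left_mono sum_nonneg)
      (auto simp: p_def)
  finally have "(\<Sum>y\<in>A. q y) \<le> (\<Sum>y\<in>A. (\<Sum>x\<in>?V. p x) * (1 + D / s * ?e))" by simp
  moreover have "A \<noteq> {}" using cA s by auto
  \<comment> \<open>Some admissible \<open>y\<close> does no worse than the bound on the
    average.\<close>
  ultimately obtain y where y: "y \<in> A" "q y \<le> (\<Sum>x\<in>?V. p x) * (1 + D / s * ?e)"
    using finA by (meson not_le sum_strict_mono)
  define \<psi> where "\<psi> = \<phi>(v := y)"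
  have \<psi>: "\<psi> v = y" "\<And>u. u \<in> U' \<Longrightarrow> \<psi> u = \<phi> u" using U' by (auto simp: \<psi>_def)
  have \<psi>im: "\<psi> ` U' = \<phi> ` U'" using \<psi> by (auto simp: image_iff)
  have "exp (\<mu> * (\<Sum>u\<in>U. w u * of_bool ({x, \<psi> u} \<notin> edges G)))
      = p x * (1 + of_bool ({x, y} \<notin> edges G) * ?e)" for x
  proof -
    have "(\<Sum>u\<in>U. w u * of_bool ({x, \<psi> u} \<notin> edges G)) =
       w v * of_bool ({x, y} \<notin> edges G) + (\<Sum>u\<in>U'. w u * of_bool ({x, \<phi> u} \<notin> edges G))"
    proof -
      have "(\<Sum>u\<in>U'. w u * of_bool ({x, \<psi> u} \<notin> edges G)) =
          (\<Sum>u\<in>U'. w u * of_bool ({x, \<phi> u} \<notin> edges G))"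
        by (intro sum.cong refl) (simp only: \<psi>)
      then show ?thesis using U' \<psi>(1) by simp
    qed
    then have "exp (\<mu> * (\<Sum>u\<in>U. w u * of_bool ({x, \<psi> u} \<notin> edges G)))
        = exp (\<mu> * (w v * of_bool ({x, y} \<notin> edges G))) * p x"
      unfolding p_def exp_add[symmetric] by (simp add: distrib_left)
    then show ?thesis by simp
  qed
  then have "(\<Sum>x\<in>?V. exp (\<mu> * (\<Sum>u\<in>U. w u * of_bool ({x, \<psi> u} \<notin> edges G)))) = q y"
    by (simp add: q_def)
  also have "\<dots> \<le> (real (card ?V) * (\<Prod>v\<in>U'. 1 + D / s * (exp (\<mu> * w v) - 1))) * (1 + D / s * ?e)"
    using y(2) pot s D0 e0 unfolding p_def[symmetric]
    by (meson mult_right_mono order_trans add_nonneg_nonneg zero_le_one mult_nonneg_nonneg divide_nonneg_pos)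
  also have "\<dots> = real (card ?V) * (\<Prod>v\<in>U. 1 + D / s * (exp (\<mu> * w v) - 1))"
    using U' by (simp add: mult_ac)
  finally have "(\<Sum>x\<in>?V. exp (\<mu> * (\<Sum>u\<in>U. w u * of_bool ({x, \<psi> u} \<notin> edges G))))
      \<le> real (card ?V) * (\<Prod>v\<in>U. 1 + D / s * (exp (\<mu> * w v) - 1))" .
  moreover have "inj_on \<psi> U"
  proof -
    have "inj_on \<psi> U'" using inj \<psi>(2) by (simp add: inj_on_def)
    moreover have "y \<notin> \<phi> ` U'" using y(1) by (simp add: A_def)
    ultimately show ?thesis unfolding U'(1) inj_on_insert \<psi>(1) using \<psi>im by blast
  qed
  moreover have "\<psi> ` U \<subseteq> ?V"
    unfolding U'(1) image_insert \<psi>im \<psi>(1) using im y(1) by (simp add: A_def)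
  moreover have "{\<psi> a, \<psi> b} \<in> edges G" if ab: "a \<in> U" "b \<in> U" "{a, b} \<in> edges T" for a b
  proof -
    have new: "{\<phi> u, y} \<in> edges G" if "u \<in> U'" "{u, v} \<in> edges T" for u
      using that y simple_graph_edgeD[OF T that(2)] by (auto simp: A_def B_def nbhd_def)
    from ab consider "a = v" "b = v" | "a = v" "b \<in> U'" | "a \<in> U'" "b = v" | "a \<in> U'" "b \<in> U'"
      unfolding U'(1) by blast
    then show ?thesis
    proof cases
      case 1
      then show ?thesis using ab simple_graph_irrefl[OF T, of v] by simp
    next
      case 2
      then show ?thesis using ab new[of b] \<psi> by (simp add: insert_commute)
    next
      case 3
      then show ?thesis using ab new[of a] \<psi> by simp
    next
      case 4
      then show ?thesis using ab ed[of a b] \<psi> by simp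
    qed
  qed
  ultimately show ?case by (intro exI[of _ \<psi>]) simp
qed

text \<open>Swapping an incompatible pair decreases the number of incompatible pairs; this avoids Hall's theorem.\<close>

lemma compatible_bijection:
  fixes R :: "'a \<Rightarrow> 'b \<Rightarrow> bool" and d :: real
  assumes fin: "finite I" "finite J" and card: "card I = card J"
    and few: "\<And>i. i \<in> I \<Longrightarrow> real (card {x \<in> J. \<not> R i x}) \<le> d"
    and many: "\<And>x. x \<in> J \<Longrightarrow> real (card {i \<in> I. R i x}) > d"
  shows "\<exists>g. bij_betw g I J \<and> (\<forall>i\<in>I. R i (g i))"
proof -
  define bad where "bad g = card {i \<in> I. \<not> R i (g i)}" for g
  obtain g0 where "bij_betw g0 I J" using fin card by (metis finite_same_card_bij)
  then obtain g where g: "bij_betw g I J" and min: "\<And>h. bij_betw h I J \<Longrightarrow> bad g \<le> bad h"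
    using ex_has_least_nat[of "\<lambda>g. bij_betw g I J" g0 bad] by blast
  have "R i (g i)" if i: "i \<in> I" for i
  proof (rule ccontr)
    assume neg: "\<not> R i (g i)"
    have gi: "g i \<in> J" using g i by (auto simp: bij_betw_def)
    have "bij_betw g {j \<in> I. \<not> R i (g j)} {x \<in> J. \<not> R i x}"
      using g by (auto simp: bij_betw_def inj_on_def)
    then have "card {j \<in> I. \<not> R i (g j)} = card {x \<in> J. \<not> R i x}" by (rule bij_betw_same_card)
    then have "card {j \<in> I. \<not> R i (g j)} < card {j \<in> I. R j (g i)}"
      using few[OF i] many[OF gi] by linarith
    \<comment> \<open>More indices \<open>j\<close> are compatible with \<open>g i\<close> than have
      an image incompatible with \<open>i\<close>. Hence some \<open>j\<close> can exchange images
      with \<open>i\<close>, after which both pairs are compatible.\<close>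
    then have "\<not> {j \<in> I. R j (g i)} \<subseteq> {j \<in> I. \<not> R i (g j)}"
      using fin by (metis (no_types, lifting) card_mono finite_Collect_conjI finite_subset mem_Collect_eq not_le subsetI)
    then obtain j where j: "j \<in> I" "R j (g i)" "R i (g j)" by blast
    then have ij: "i \<noteq> j" using neg by auto
    define h where "h = g \<circ> Transposition.transpose i j"
    have h: "bij_betw h I J"
      unfolding h_def using i j g by (metis bij_betw_trans bij_betw_transpose_iff)
    have "{l \<in> I. \<not> R l (h l)} \<subset> {l \<in> I. \<not> R l (g l)}"
      using i j ij neg by (auto simp: h_def Transposition.transpose_def)
    then have "bad h < bad g" unfolding bad_def using fin by (intro psubset_card_mono) auto
    then show False using min[OF h] by simp
  qed
  then show ?thesis using g by blast
qed

section \<open>Completing the embedding by a matching\<close>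

lemma sum_card_nbhd_swap:
  assumes T: "simple_graph T" and fin: "finite A" "finite B"
  shows "(\<Sum>v\<in>A. card (nbhd T v \<inter> B)) = (\<Sum>v\<in>B. card (nbhd T v \<inter> A))"
proof -
  have c: "card (nbhd T v \<inter> X) = (\<Sum>u\<in>X. of_bool (u \<in> nbhd T v))" if "finite X" for v X
    using that by (simp add: of_bool_def sum.If_cases Int_commute Int_def)
  have "(\<Sum>v\<in>A. card (nbhd T v \<inter> B)) = (\<Sum>v\<in>A. \<Sum>u\<in>B. of_bool (u \<in> nbhd T v))"
    by (simp only: c[OF fin(2)])
  also have "\<dots> = (\<Sum>u\<in>B. \<Sum>v\<in>A. of_bool (u \<in> nbhd T v))" by (rule sum.swap)
  also have "\<dots> = (\<Sum>u\<in>B. card (nbhd T u \<inter> A))"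
    by (simp only: c[OF fin(1)] nbhd_sym[OF T])
  finally show ?thesis .
qed

text \<open>Convexity on the segment from 0 to \<open>z\<close>. It bounds exponentials of weights
  in \<open>[0, M]\<close> linearly in the weight, so that a bound on the total weight
  suffices.\<close>

lemma exp_le_chord:
  fixes t z :: real
  assumes "0 \<le> t" "t \<le> 1"
  shows "exp (t * z) - 1 \<le> t * (exp z - 1)"
  using convex_onD[OF exp_convex assms, of 0 z] by (simp add: algebra_simps)

lemma contains_if_large_independent_set:
  fixes T :: "'a graph" and G :: "'b graph" and D M \<mu> :: real and K :: nat
  assumes T: "simple_graph T" and ac: "\<nexists>xs. graph_cycle T xs"
    and G: "finite (verts G)" and n: "card (verts G) = card (verts T)"
    and D: "\<And>x. x \<in> verts G \<Longrightarrow> real (card {y \<in> verts G. {x, y} \<notin> edges G}) \<le> D"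
    and D0: "D \<ge> 0"
    and I: "I \<subseteq> verts T" and indep: "\<And>u v. u \<in> I \<Longrightarrow> v \<in> I \<Longrightarrow> {u, v} \<notin> edges T"
    and K: "\<And>i. i \<in> I \<Longrightarrow> card (nbhd T i) \<le> K"
    and M: "M > 0" "\<And>v. v \<in> verts T \<Longrightarrow> real (card (nbhd T v \<inter> I)) \<le> M"
    and m: "card I > 0" "2 * D \<le> card I" and \<mu>: "\<mu> > 0"
    and main: "ln (card (verts T)) + 2 * D * K * exp (\<mu> * M) / M < \<mu> * (card I - K * D)"
  shows "contains G T"
proof -
  define m where "m = real (card I)"
  define U where "U = verts T - I"
  have fin: "finite (verts T)" "finite U" "finite I"
    using T I finite_subset[of I] by (auto simp: simple_graph_def U_def)
  define w where "w v = real (card (nbhd T v \<inter> I))" for v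
  have m0: "m > 0" using m by (simp add: m_def)
  have cU: "card U + card I = card (verts T)"
    using fin I by (simp add: U_def card_Diff_subset card_mono)
  \<comment> \<open>Since \<open>D\<close> is at most half of \<open>card I\<close>, the other half
    of \<open>card I\<close> can serve as the slack \<open>s = m / 2\<close>.\<close>
  have sz: "real (card U) + D + m / 2 \<le> real (card (verts G))"
    using cU m n by (simp add: m_def)
  obtain \<phi> where inj: "inj_on \<phi> U" and im: "\<phi> ` U \<subseteq> verts G"
    and ed: "\<And>u v. u \<in> U \<Longrightarrow> v \<in> U \<Longrightarrow> {u, v} \<in> edges T \<Longrightarrow> {\<phi> u, \<phi> v} \<in> edges G"
    and pot: "(\<Sum>x\<in>verts G. exp (\<mu> * (\<Sum>v\<in>U. w v * of_bool ({x, \<phi> v} \<notin> edges G))))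
      \<le> real (card (verts G)) * (\<Prod>v\<in>U. 1 + D / (m / 2) * (exp (\<mu> * w v) - 1))"
    using greedy_embedding[OF T ac _ G D D0 _ sz, of w \<mu>] m0 \<mu> by (auto simp: U_def w_def)
  define lost where "lost x = (\<Sum>v\<in>U. w v * of_bool ({x, \<phi> v} \<notin> edges G))" for x
  have W: "(\<Sum>v\<in>U. w v) \<le> K * m"
  proof -
    have "(\<Sum>v\<in>U. card (nbhd T v \<inter> I)) = (\<Sum>i\<in>I. card (nbhd T i \<inter> U))"
      using sum_card_nbhd_swap[OF T] fin by blast
    also have "\<dots> \<le> (\<Sum>i\<in>I. K)"
      using K finite_nbhd[OF T] by (intro sum_mono) (meson Int_lower1 card_mono le_trans)
    finally have "real (\<Sum>v\<in>U. card (nbhd T v \<inter> I)) \<le> real (card I * K)"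
      by (subst of_nat_le_iff) simp
    then show ?thesis by (simp add: w_def m_def mult.commute)
  qed
  have "(\<Prod>v\<in>U. 1 + D / (m / 2) * (exp (\<mu> * w v) - 1))
      \<le> (\<Prod>v\<in>U. exp (2 * D / m * (exp (\<mu> * w v) - 1)))"
  proof (intro prod_mono conjI)
    fix v
    have "exp (\<mu> * w v) - 1 \<ge> 0" using \<mu> by (simp add: w_def)
    then show "0 \<le> 1 + D / (m / 2) * (exp (\<mu> * w v) - 1)" using D0 m0 by simp
    show "1 + D / (m / 2) * (exp (\<mu> * w v) - 1) \<le> exp (2 * D / m * (exp (\<mu> * w v) - 1))"
      using exp_ge_add_one_self[of "2 * D / m * (exp (\<mu> * w v) - 1)"] by (simp add: mult.commute)
  qed
  also have "\<dots> = exp (2 * D / m * (\<Sum>v\<in>U. exp (\<mu> * w v) - 1))"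
    using fin by (simp add: exp_sum sum_distrib_left)
  also have "\<dots> \<le> exp (2 * D * K * exp (\<mu> * M) / M)"
  proof -
    have "(\<Sum>v\<in>U. exp (\<mu> * w v) - 1) \<le> (\<Sum>v\<in>U. w v / M * (exp (\<mu> * M) - 1))"
    proof (rule sum_mono)
      fix v assume "v \<in> U"
      then have "w v \<le> M" using M by (simp add: w_def U_def)
      then show "exp (\<mu> * w v) - 1 \<le> w v / M * (exp (\<mu> * M) - 1)"
        using exp_le_chord[of "w v / M" "\<mu> * M"] M(1) by (simp add: w_def mult.commute)
    qed
    also have "\<dots> = (\<Sum>v\<in>U. w v) * ((exp (\<mu> * M) - 1) / M)"
      unfolding sum_distrib_right by simp
    also have "\<dots> \<le> (K * m) * (exp (\<mu> * M) / M)"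
      using W M(1) \<mu> m0 by (intro mult_mono divide_right_mono) auto
    finally have "2 * D / m * (\<Sum>v\<in>U. exp (\<mu> * w v) - 1) \<le> 2 * D / m * ((K * m) * (exp (\<mu> * M) / M))"
      using D0 m0 by (intro mult_left_mono) auto
    also have "\<dots> = 2 * D * K * exp (\<mu> * M) / M" using m0 by simp
    finally show ?thesis by simp
  qed
  finally have "real (card (verts G)) * (\<Prod>v\<in>U. 1 + D / (m / 2) * (exp (\<mu> * w v) - 1))
      \<le> real (card (verts T)) * exp (2 * D * K * exp (\<mu> * M) / M)"
    unfolding n by (rule mult_left_mono) simp
  also have "\<dots> = exp (ln (card (verts T)) + 2 * D * K * exp (\<mu> * M) / M)"
    using cU m by (simp add: exp_add)
  also have "\<dots> < exp (\<mu> * (m - K * D))" using main by (simp add: m_def)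
  finally have pot': "(\<Sum>x\<in>verts G. exp (\<mu> * lost x)) < exp (\<mu> * (m - K * D))"
    using pot unfolding lost_def by linarith
  \<comment> \<open>A single term of the potential is at most the whole sum; this is Markov's
    inequality together with the union bound over all targets.\<close>
  have lost: "lost x < m - K * D" if "x \<in> verts G" for x
  proof -
    have "exp (\<mu> * lost x) \<le> (\<Sum>x\<in>verts G. exp (\<mu> * lost x))"
      using G that by (intro member_le_sum) auto
    with pot' have "\<mu> * lost x < \<mu> * (m - K * D)" by (meson exp_less_cancel_iff le_less_trans)
    with \<mu> show ?thesis by simp
  qed
  define J where "J = verts G - \<phi> ` U"
  \<comment> \<open>\<open>R i x\<close> says that \<open>x\<close> may become the image of
    \<open>i\<close>. As \<open>I\<close> is independent, all neighbours of \<open>i\<close> lie in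
    \<open>U\<close> and already have images.\<close>
  define R where "R i x \<longleftrightarrow> (\<forall>v\<in>nbhd T i. {x, \<phi> v} \<in> edges G)" for i x
  have nbI: "nbhd T i \<subseteq> U" if "i \<in> I" for i
    using that indep by (auto simp: nbhd_def U_def)
  have "\<exists>g. bij_betw g I J \<and> (\<forall>i\<in>I. R i (g i))"
  proof (rule compatible_bijection[where d = "K * D"])
    show "finite I" "finite J" using fin G by (auto simp: J_def)
    show "card I = card J"
      using cU n im inj fin by (simp add: J_def card_Diff_subset card_image)
  next
    fix i assume i: "i \<in> I"
    have "{x \<in> J. \<not> R i x} \<subseteq> (\<Union>v\<in>nbhd T i. {y \<in> verts G. {\<phi> v, y} \<notin> edges G})"
      by (auto simp: J_def R_def insert_commute)
    then have "card {x \<in> J. \<not> R i x} \<le> card (\<Union>v\<in>nbhd T i. {y \<in> verts G. {\<phi> v, y} \<notin> edges G})"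
      using G finite_nbhd[OF T] by (intro card_mono) auto
    also have "\<dots> \<le> (\<Sum>v\<in>nbhd T i. card {y \<in> verts G. {\<phi> v, y} \<notin> edges G})"
      using finite_nbhd[OF T] by (rule card_UN_le)
    finally have "real (card {x \<in> J. \<not> R i x}) \<le> (\<Sum>v\<in>nbhd T i. real (card {y \<in> verts G. {\<phi> v, y} \<notin> edges G}))"
      unfolding of_nat_sum[symmetric] of_nat_le_iff .
    also have "\<dots> \<le> (\<Sum>v\<in>nbhd T i. D)" using nbI[OF i] im by (intro sum_mono D) auto
    also have "\<dots> = card (nbhd T i) * D" by simp
    also have "\<dots> \<le> K * D" using K[OF i] D0 by (intro mult_right_mono) auto
    finally show "real (card {x \<in> J. \<not> R i x}) \<le> K * D" .
  next
    fix x assume "x \<in> J"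
    then have x: "x \<in> verts G" by (simp add: J_def)
    \<comment> \<open>Only a neighbour whose image is not adjacent to \<open>x\<close> bars an
      element of \<open>I\<close> from \<open>x\<close>, and such a vertex \<open>v\<close> bars at
      most \<open>w v\<close> elements. So at most \<open>lost x\<close> elements are
      barred.\<close>
    define B where "B = {v \<in> U. {x, \<phi> v} \<notin> edges G}"
    have "{i \<in> I. \<not> R i x} \<subseteq> (\<Union>v\<in>B. nbhd T v \<inter> I)"
      using nbI nbhd_sym[OF T] by (fastforce simp: R_def B_def)
    then have "card {i \<in> I. \<not> R i x} \<le> card (\<Union>v\<in>B. nbhd T v \<inter> I)"
      using fin by (intro card_mono) (auto simp: B_def)
    also have "\<dots> \<le> (\<Sum>v\<in>B. card (nbhd T v \<inter> I))"
      using fin by (intro card_UN_le) (auto simp: B_def)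
    finally have "real (card {i \<in> I. \<not> R i x}) \<le> (\<Sum>v\<in>B. w v)"
      unfolding w_def of_nat_sum[symmetric] of_nat_le_iff .
    also have "\<dots> = lost x"
      unfolding lost_def B_def using fin by (intro sum.mono_neutral_cong_left) auto
    finally have "real (card {i \<in> I. \<not> R i x}) < m - K * D" using lost[OF x] by linarith
    moreover have "card {i \<in> I. R i x} + card {i \<in> I. \<not> R i x} = card I"
      using fin by (subst card_Un_disjoint[symmetric]) (auto intro: arg_cong[of _ _ card])
    ultimately show "real (card {i \<in> I. R i x}) > K * D" unfolding m_def by linarith
  qed
  then obtain g where g: "bij_betw g I J" and gR: "\<And>i. i \<in> I \<Longrightarrow> R i (g i)" by blast
  define h where "h v = (if v \<in> I then g v else \<phi> v)" for v
  have "bij_betw h I J" using g by (subst bij_betw_cong[of I h g]) (auto simp: h_def)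
  moreover have "bij_betw h U (\<phi> ` U)"
    using inj by (subst bij_betw_cong[of U h \<phi>]) (auto simp: h_def U_def bij_betw_def)
  ultimately have "bij_betw h (I \<union> U) (J \<union> \<phi> ` U)"
    by (rule bij_betw_combine) (auto simp: J_def)
  moreover have "I \<union> U = verts T" "J \<union> \<phi> ` U = verts G" using I im by (auto simp: U_def J_def)
  ultimately have bij: "bij_betw h (verts T) (verts G)" by simp
  show ?thesis
  proof (rule contains_if_embedding[OF T G bij])
    fix u v assume e: "{u, v} \<in> edges T"
    then have uv: "u \<in> verts T" "v \<in> verts T" "u \<in> nbhd T v" "v \<in> nbhd T u"
      using simple_graph_edgeD[OF T e] by (auto simp: nbhd_def insert_commute)
    consider "u \<in> I" "v \<in> U" | "v \<in> I" "u \<in> U" | "u \<in> U" "v \<in> U"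
      using uv indep e by (auto simp: U_def)
    then show "{h u, h v} \<in> edges G"
    proof cases
      case 1
      then show ?thesis using gR[of u] uv by (auto simp: R_def h_def U_def)
    next
      case 2
      then show ?thesis using gR[of v] uv by (auto simp: R_def h_def U_def insert_commute)
    next
      case 3
      then show ?thesis using ed[of u v] e by (auto simp: h_def U_def)
    qed
  qed
qed

text \<open>For an independent subset of \<open>X\<close> of maximum size, the closed neighbourhoods
  of its members cover \<open>X\<close>, and each has at most \<open>K + 1\<close> elements.\<close>

lemma maximal_independent_subset:
  assumes T: "simple_graph T" and X: "X \<subseteq> verts T" and K: "\<And>x. x \<in> X \<Longrightarrow> card (nbhd T x) \<le> K"
  shows "\<exists>I \<subseteq> X. (\<forall>u\<in>I. \<forall>v\<in>I. {u, v} \<notin> edges T) \<and> card X \<le> (K + 1) * card I"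
proof -
  have fin: "finite X" using T X finite_subset[of X] by (auto simp: simple_graph_def)
  define P where "P I \<longleftrightarrow> I \<subseteq> X \<and> (\<forall>u\<in>I. \<forall>v\<in>I. {u, v} \<notin> edges T)" for I
  have "P {}" by (simp add: P_def)
  moreover have "card I < Suc (card X)" if "P I" for I
    using that fin by (simp add: P_def card_mono less_Suc_eq_le)
  ultimately obtain I where I: "P I" and mx: "\<And>J. P J \<Longrightarrow> card J \<le> card I"
    using ex_has_greatest_nat[of P "{}" card "Suc (card X)"] by blast
  have finI: "finite I" using I fin finite_subset by (auto simp: P_def)
  have "X \<subseteq> (\<Union>i\<in>I. insert i (nbhd T i))"
  proof (rule ccontr)
    assume "\<not> ?thesis"
    then obtain x where x: "x \<in> X" "x \<notin> I" "\<And>i. i \<in> I \<Longrightarrow> x \<notin> nbhd T i" by blast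
    then have "\<And>i. i \<in> I \<Longrightarrow> {x, i} \<notin> edges T" using X by (auto simp: nbhd_def)
    then have "P (insert x I)"
      using I x simple_graph_irrefl[OF T, of x] by (auto simp: P_def insert_commute)
    from mx[OF this] show False using x finI by simp
  qed
  then have "card X \<le> card (\<Union>i\<in>I. insert i (nbhd T i))"
    using finI finite_nbhd[OF T] by (intro card_mono) auto
  also have "\<dots> \<le> (\<Sum>i\<in>I. card (insert i (nbhd T i)))" using finI by (rule card_UN_le)
  also have "\<dots> \<le> (\<Sum>i\<in>I. K + 1)"
    using I K finite_nbhd[OF T] by (intro sum_mono) (fastforce simp: P_def card_insert_if le_Suc_eq)
  finally show ?thesis using I by (auto simp: P_def mult.commute)
qed

subsection \<open>Dense graphs contain all trees\<close>

text \<open>Apart from \<open>?H\<close> and \<open>?X\<close> there is only the set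
  \<open>B\<close> of vertices of degree at most \<open>K\<close> with a neighbour of degree above
  \<open>M\<close>. The degree sum, at most \<open>2 * card (verts T)\<close>, gets at least
  \<open>card B\<close> from the set \<open>A\<close> of vertices of degree above \<open>M\<close>,
  and at least \<open>card B + card (B - ?L)\<close> from \<open>B\<close> itself. Hence
  \<open>3 * card B \<le> 2 * card (verts T) + card ?L\<close>. The second claim is Markov's
  inequality for degrees.\<close>

lemma tree_vertex_count:
  fixes T :: "'a graph" and K M :: nat
  assumes T: "simple_graph T" and ac: "\<nexists>xs. graph_cycle T xs"
    and ne: "\<And>v. v \<in> verts T \<Longrightarrow> nbhd T v \<noteq> {}" and KM: "K \<le> M"
  shows "card (verts T) \<le> card {v \<in> verts T. card (nbhd T v) \<le> 1}
      + 3 * card {v \<in> verts T. card (nbhd T v) > K}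
      + 3 * card {v \<in> verts T. card (nbhd T v) \<le> K \<and> (\<forall>u\<in>nbhd T v. card (nbhd T u) \<le> M)}"
    (is "_ \<le> card ?L + 3 * card ?H + 3 * card ?X")
    and "(K + 1) * card {v \<in> verts T. card (nbhd T v) > K} \<le> 2 * card (verts T)"
proof -
  let ?V = "verts T" and ?deg = "\<lambda>v. card (nbhd T v)"
  have fin: "finite ?V" using T by (simp add: simple_graph_def)
  have deg1: "?deg v \<ge> 1" if "v \<in> ?V" for v
    using ne[OF that] finite_nbhd[OF T, of v] by (simp add: Suc_le_eq card_gt_0_iff)
  have "nbhd T v \<inter> ?V = nbhd T v" for v by (auto simp: nbhd_def)
  then have sum_deg: "(\<Sum>v\<in>?V. ?deg v) \<le> 2 * card ?V"
    using acyclic_degree_sum[OF T ac subset_refl] by simp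
  have "(\<Sum>v\<in>?H. K + 1) \<le> (\<Sum>v\<in>?H. ?deg v)" by (rule sum_mono) auto
  also have "\<dots> \<le> (\<Sum>v\<in>?V. ?deg v)" using fin by (intro sum_mono2) auto
  finally show "(K + 1) * card ?H \<le> 2 * card ?V" using sum_deg by (simp add: mult.commute)
  define A where "A = {v \<in> ?V. ?deg v > M}"
  define B where "B = {v \<in> ?V. ?deg v \<le> K \<and> (\<exists>u\<in>nbhd T v. ?deg u > M)}"
  have finAB: "finite A" "finite B" using fin by (auto simp: A_def B_def)
  have V: "?V = ?H \<union> ?X \<union> B" by (auto simp: B_def not_le)
  have "card (?H \<union> ?X \<union> B) \<le> card ?H + card ?X + card B"
    by (meson card_Un_le order_trans add_right_mono)
  then have cV: "card ?V \<le> card ?H + card ?X + card B" using V by simp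
  have "card B = (\<Sum>v\<in>B. 1)" by simp
  also have "\<dots> \<le> (\<Sum>v\<in>B. card (nbhd T v \<inter> A))"
  proof (rule sum_mono)
    fix v assume "v \<in> B"
    then have "nbhd T v \<inter> A \<noteq> {}" by (auto simp: A_def B_def nbhd_def)
    then show "1 \<le> card (nbhd T v \<inter> A)" using finAB by (simp add: Suc_le_eq card_gt_0_iff)
  qed
  also have "\<dots> = (\<Sum>v\<in>A. card (nbhd T v \<inter> B))" using sum_card_nbhd_swap[OF T] finAB by blast
  also have "\<dots> \<le> (\<Sum>v\<in>A. ?deg v)" using finite_nbhd[OF T] by (intro sum_mono card_mono) auto
  finally have degA: "card B \<le> (\<Sum>v\<in>A. ?deg v)" .
  have "(\<Sum>v\<in>B. of_bool (v \<notin> ?L)) = card (B \<inter> {v. v \<notin> ?L})"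
    using finAB by (simp only: sum_of_bool_eq of_nat_id)
  also have "B \<inter> {v. v \<notin> ?L} = B - ?L" by blast
  finally have "card B + card (B - ?L) = (\<Sum>v\<in>B. 1 + of_bool (v \<notin> ?L))"
    by (simp only: sum.distrib card_eq_sum)
  \<comment> \<open>Degrees are at least 1, and at least 2 outside the leaves.\<close>
  also have "\<dots> \<le> (\<Sum>v\<in>B. ?deg v)"
    using deg1 by (intro sum_mono) (fastforce simp: B_def)
  finally have degB: "card B + card (B - ?L) \<le> (\<Sum>v\<in>B. ?deg v)" .
  have AB: "A \<inter> B = {}" "A \<union> B \<subseteq> ?V" using KM by (auto simp: A_def B_def)
  have cAB: "card (?V - (A \<union> B)) + (card A + card B) = card ?V"
    using fin AB finAB by (metis card_Diff_subset card_Un_disjoint card_mono finite_Un le_add_diff_inverse2)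
  have "(\<Sum>v\<in>?V. ?deg v) = (\<Sum>v\<in>?V - (A \<union> B). ?deg v) + ((\<Sum>v\<in>A. ?deg v) + (\<Sum>v\<in>B. ?deg v))"
    using sum.subset_diff[OF AB(2) fin, of ?deg] sum.union_disjoint[OF finAB AB(1), of ?deg] by simp
  then have "card B + (card B + card (B - ?L)) \<le> 2 * card ?V"
    using degA degB sum_deg by linarith
  moreover have "card B \<le> card ?L + card (B - ?L)"
  proof -
    have "card B \<le> card (?L \<union> (B - ?L))" using fin finAB by (intro card_mono) auto
    then show ?thesis by (meson card_Un_le order_trans)
  qed
  ultimately show "card ?V \<le> card ?L + 3 * card ?H + 3 * card ?X" using cV by linarith
qed

text \<open>The independent set consists of the leaves, with \<open>K = 1\<close> and
  \<open>M = \<Delta>\<close>. Up to lower-order terms in \<epsilon>, the requirement is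
  \<open>ln n < \<mu> * n\<close>, and the factor \<open>1 + \<epsilon>\<close> in the exponent of
  \<open>d\<close> pays for these terms.\<close>

lemma contains_if_many_leaves:
  fixes T :: "'a graph" and G :: "'b graph" and \<epsilon> k d :: real and \<Delta> :: nat
  assumes T: "simple_graph T" "connected_graph T" "\<nexists>xs. graph_cycle T xs"
    and G: "finite (verts G)" "card (verts G) = card (verts T)"
    and n: "n = card (verts T)" "n \<ge> 3"
    and deg: "\<And>v. v \<in> verts T \<Longrightarrow> card (nbhd T v) \<le> \<Delta>"
    and D: "\<And>x. x \<in> verts G \<Longrightarrow> real (card {y \<in> verts G. {x, y} \<notin> edges G}) \<le> d * n"
    and \<epsilon>: "0 < \<epsilon>" "\<epsilon> \<le> 1"
    and d: "d = exp (- ((1 + \<epsilon>) * ln n / k))" "d \<le> \<epsilon> / 8"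
    and k: "k > 0" "k * \<Delta> \<le> n" and \<Delta>: "\<Delta> > 0" "8 / \<epsilon> * n \<le> \<Delta> * ln n"
    and L: "card {v \<in> verts T. card (nbhd T v) \<le> 1} \<ge> (1 - \<epsilon> / 8) * n"
  shows "contains G T"
proof -
  let ?L = "{v \<in> verts T. card (nbhd T v) \<le> 1}"
  \<comment> \<open>Chosen so that \<open>exp (\<mu> * \<Delta>) = 1 / d\<close>: the exponential
    term of the criterion then reduces to \<open>2 * (n / \<Delta>)\<close>, a small multiple of
    \<open>ln n\<close>.\<close>
  define \<mu> where "\<mu> = (1 + \<epsilon>) * ln n / (k * \<Delta>)"
  have lnn: "ln n > 0" using n by simp
  have \<mu>: "\<mu> > 0" using lnn k \<Delta> \<epsilon> by (simp add: \<mu>_def)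
  have d0: "d > 0" using d by simp
  have "\<mu> * \<Delta> = (1 + \<epsilon>) * ln n / k" using \<Delta> k by (simp add: \<mu>_def)
  then have e: "exp (\<mu> * \<Delta>) = 1 / d" unfolding d(1) by (simp add: exp_minus divide_simps)
  show ?thesis
  proof (rule contains_if_large_independent_set[where I = ?L and K = 1 and M = \<Delta> and \<mu> = \<mu> and D = "d * n"])
    show "{u, v} \<notin> edges T" if "u \<in> ?L" "v \<in> ?L" for u v
      using leaves_not_adjacent[OF T(1,2)] n that by auto
    show "real (card (nbhd T v \<inter> ?L)) \<le> \<Delta>" if "v \<in> verts T" for v
      using deg[OF that] finite_nbhd[OF T(1)] by (meson Int_lower1 card_mono le_trans of_nat_le_iff)
    have "(1 - \<epsilon> / 8) * n > 0" using n \<epsilon> by simp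
    then have "real (card ?L) > 0" using L by linarith
    then show "card ?L > 0" by simp
    have "2 * d \<le> 1 - \<epsilon> / 8" using d \<epsilon> by linarith
    then have "2 * d * n \<le> (1 - \<epsilon> / 8) * n" by (intro mult_right_mono) auto
    then show "2 * (d * n) \<le> card ?L" using L by simp
    have "n = \<epsilon> / 8 * (8 / \<epsilon> * n)" using \<epsilon> by simp
    also have "\<dots> \<le> \<epsilon> / 8 * (\<Delta> * ln n)" using \<Delta> \<epsilon> by (intro mult_left_mono) auto
    finally have n\<Delta>: "n / \<Delta> \<le> \<epsilon> / 8 * ln n"
      using \<Delta>(1) by (simp add: pos_divide_le_eq mult_ac)
    have "ln n + 2 * (d * n) * real 1 * exp (\<mu> * \<Delta>) / \<Delta> = ln n + 2 * (n / \<Delta>)"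
      using e d0 by simp
    also have "\<dots> \<le> (1 + \<epsilon> / 4) * ln n" using n\<Delta> by (simp add: algebra_simps)
    also have "\<dots> < ((1 + \<epsilon>) * (1 - \<epsilon> / 4)) * ln n"
    proof -
      have "\<epsilon> * \<epsilon> \<le> \<epsilon> * 1" using \<epsilon> by (intro mult_left_mono) auto
      moreover have "(1 + \<epsilon>) * (1 - \<epsilon> / 4) = 1 + 3 * \<epsilon> / 4 - \<epsilon> * \<epsilon> / 4"
        by (simp add: field_simps)
      ultimately have "1 + \<epsilon> / 4 < (1 + \<epsilon>) * (1 - \<epsilon> / 4)" using \<epsilon> by linarith
      then show ?thesis using lnn by (rule mult_strict_right_mono)
    qed
    \<comment> \<open>Here \<open>k * \<Delta> \<le> n\<close> enters: at least \<open>k\<close>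
      vertices of full degree \<Delta> are needed to carry all leaves.\<close>
    also have "\<dots> \<le> ((1 + \<epsilon>) * (1 - \<epsilon> / 4)) * ln n * (n / (k * \<Delta>))"
    proof -
      have "n / (k * \<Delta>) \<ge> 1" using k \<Delta> by (simp add: field_simps)
      moreover have "((1 + \<epsilon>) * (1 - \<epsilon> / 4)) * ln n \<ge> 0" using \<epsilon> lnn by simp
      ultimately show ?thesis by (metis mult.right_neutral mult_left_mono)
    qed
    also have "\<dots> = \<mu> * ((1 - \<epsilon> / 4) * n)" by (simp add: \<mu>_def)
    also have "\<dots> \<le> \<mu> * (card ?L - real 1 * (d * n))"
    proof (rule mult_left_mono)
      have "d * n \<le> \<epsilon> / 8 * n" using d by (intro mult_right_mono) auto
      then show "(1 - \<epsilon> / 4) * n \<le> card ?L - real 1 * (d * n)" using L by (simp add: algebra_simps)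
    qed (use \<mu> in simp)
    finally show "ln (card (verts T)) + 2 * (d * n) * real 1 * exp (\<mu> * \<Delta>) / \<Delta>
        < \<mu> * (card ?L - real 1 * (d * n))"
      by (simp add: n)
  qed (use T G D d0 \<Delta> \<mu> in auto)
qed

text \<open>With fewer leaves there are linearly many vertices of degree at most \<open>K\<close>
  without a neighbour of large degree, and an independent set of at least \<open>c * n\<close> of
  them can be used. As no vertex has more than \<open>M\<close> neighbours in it, the rate
  \<open>\<mu> = 1 / M\<close> keeps \<open>exp (\<mu> * M)\<close> constant.\<close>

lemma contains_if_few_leaves:
  fixes T :: "'a graph" and G :: "'b graph" and \<gamma> d c :: real and K :: nat
  assumes T: "simple_graph T" "connected_graph T" "\<nexists>xs. graph_cycle T xs"
    and G: "finite (verts G)" "card (verts G) = card (verts T)"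
    and n: "n = card (verts T)" "n \<ge> 3"
    and D: "\<And>x. x \<in> verts G \<Longrightarrow> real (card {y \<in> verts G. {x, y} \<notin> edges G}) \<le> d * n"
    and \<gamma>: "0 < \<gamma>" and K: "K + 1 \<ge> 12 / \<gamma>" "K \<ge> 1"
    and c: "c = \<gamma> / (6 * (K + 1))" and d: "0 < d" "14 * K * d < c"
    and Kn: "K \<le> c / 2 * n / ln n"
    and L: "card {v \<in> verts T. card (nbhd T v) \<le> 1} \<le> (1 - \<gamma>) * n"
  shows "contains G T"
proof -
  let ?L = "{v \<in> verts T. card (nbhd T v) \<le> 1}" and ?H = "{v \<in> verts T. card (nbhd T v) > K}"
  \<comment> \<open>This makes \<open>M * ln n\<close> equal to \<open>c / 2 * n\<close>, half of
    the guaranteed size of the independent set.\<close>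
  define M where "M = c / 2 * n / ln n"
  define X where "X = {v \<in> verts T. card (nbhd T v) \<le> K \<and> (\<forall>u\<in>nbhd T v. card (nbhd T u) \<le> nat \<lfloor>M\<rfloor>)}"
  have lnn: "ln n > 0" using n by simp
  have c0: "c > 0" using c \<gamma> by simp
  have M0: "M > 0" using c0 lnn n by (simp add: M_def)
  have ne: "nbhd T v \<noteq> {}" if "v \<in> verts T" for v
    using connected_nbhd_nonempty[OF T(1,2) that] n by simp
  have "K \<le> nat \<lfloor>M\<rfloor>" using Kn M_def by (simp add: le_nat_floor)
  note count = tree_vertex_count[OF T(1,3) ne this, folded X_def]
  have "real (card (verts T)) \<le> real (card ?L + 3 * card ?H + 3 * card X)"
    using count(1) by (subst of_nat_le_iff) simp
  then have c1: "n \<le> card ?L + 3 * real (card ?H) + 3 * card X" by (simp add: n)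
  have "real ((K + 1) * card ?H) \<le> real (2 * card (verts T))"
    using count(2) by (subst of_nat_le_iff)
  then have c2: "real (K + 1) * real (card ?H) \<le> 2 * real n"
    unfolding of_nat_mult by (simp only: n of_nat_numeral)
  have "12 / \<gamma> * real (card ?H) \<le> real (K + 1) * real (card ?H)" using K by (intro mult_right_mono) auto
  then have "12 / \<gamma> * real (card ?H) \<le> 2 * real n" using c2 by linarith
  then have "\<gamma> / 12 * (12 / \<gamma> * real (card ?H)) \<le> \<gamma> / 12 * (2 * real n)"
    using \<gamma> by (intro mult_left_mono) auto
  then have "real (card ?H) \<le> \<gamma> / 6 * n" using \<gamma> by simp
  \<comment> \<open>Of the \<open>\<gamma> * n\<close> missing leaves, \<open>3 * card ?H\<close>
    accounts for at most half; the rest is at most \<open>3 * card X\<close>.\<close>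
  then have cX: "card X \<ge> \<gamma> / 6 * n" using c1 L by (simp add: algebra_simps)
  have X: "X \<subseteq> verts T" "\<And>x. x \<in> X \<Longrightarrow> card (nbhd T x) \<le> K" by (auto simp: X_def)
  obtain I where I: "I \<subseteq> X" "\<And>u v. u \<in> I \<Longrightarrow> v \<in> I \<Longrightarrow> {u, v} \<notin> edges T"
    and cI: "card X \<le> (K + 1) * card I"
    using maximal_independent_subset[OF T(1) X] by blast
  have "real (card X) \<le> real (K + 1) * card I" using cI by (metis of_nat_le_iff of_nat_mult)
  then have "\<gamma> / 6 * n \<le> real (K + 1) * card I" using cX by linarith
  then have cI': "c * n \<le> card I" by (simp add: c field_simps)
  show ?thesis
  proof (rule contains_if_large_independent_set[where I = I and K = K and M = M and \<mu> = "1 / M" and D = "d * n"])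
    show "real (card (nbhd T v \<inter> I)) \<le> M" if v: "v \<in> verts T" for v
    proof (cases "card (nbhd T v) \<le> nat \<lfloor>M\<rfloor>")
      case True
      then have "card (nbhd T v \<inter> I) \<le> nat \<lfloor>M\<rfloor>"
        using finite_nbhd[OF T(1)] by (meson Int_lower1 card_mono le_trans)
      then show ?thesis using M0 by (simp add: le_nat_iff le_floor_iff)
    next
      case False
      then have "nbhd T v \<inter> X = {}" using nbhd_sym[OF T(1)] by (auto simp: X_def)
      then have "nbhd T v \<inter> I = {}" using I by auto
      then show ?thesis using M0 by simp
    qed
    have "c * n > 0" using c0 n by simp
    then have "real (card I) > 0" using cI' by linarith
    then show "card I > 0" by simp
    have Kd: "d \<le> K * d" using K d by simp
    then have "2 * d \<le> c" using d by linarith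
    then have "2 * d * n \<le> c * n" by (intro mult_right_mono) auto
    then show "2 * (d * n) \<le> card I" using cI' by simp
    \<comment> \<open>The criterion multiplied by \<open>M\<close> and divided by \<open>n\<close>.
      With \<open>exp 1 \<le> 3\<close> the terms in \<open>d\<close> add up to at most
      \<open>7 * K * d\<close>, whence the constant 14.\<close>
    have "c / 2 + 2 * K * d * exp 1 + K * d < c"
    proof -
      have "2 * K * d * exp 1 \<le> 2 * K * d * 3" using d exp_le by (intro mult_left_mono) auto
      then show ?thesis using d by linarith
    qed
    then have "(c / 2 + 2 * K * d * exp 1 + K * d) * n < c * n" using n by (intro mult_strict_right_mono) auto
    then have "c / 2 * n + 2 * (d * n) * K * exp 1 < card I - K * (d * n)"
      using cI' by (simp add: algebra_simps)
    moreover have "M * ln n = c / 2 * n" using lnn by (simp add: M_def)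
    ultimately have "(M * ln n + 2 * (d * n) * K * exp 1) / M < (card I - K * (d * n)) / M"
      using M0 by (intro divide_strict_right_mono) auto
    then show "ln (card (verts T)) + 2 * (d * n) * K * exp (1 / M * M) / M < 1 / M * (card I - K * (d * n))"
      using M0 by (simp add: n add_divide_distrib)
  qed (use T G D d M0 I in \<open>auto simp: X_def\<close>)
qed

text \<open>The deterministic part. The trees are split by whether at least
  \<open>(1 - \<epsilon> / 8) * n\<close> vertices are leaves; \<open>C\<close> and \<open>N\<close>
  serve both cases.\<close>

theorem dense_graph_contains_trees:
  fixes \<epsilon> :: real
  assumes \<epsilon>: "0 < \<epsilon>" "\<epsilon> \<le> 1"
  obtains C :: real and N :: nat where "C > 1" "N \<ge> 3"
    "\<And>n \<Delta> k T (G :: 'b graph). n \<ge> N \<Longrightarrow> k > 0 \<Longrightarrow> k * real \<Delta> \<le> n \<Longrightarrow> real \<Delta> \<ge> C * n / ln n \<Longrightarrow>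
      finite (verts G) \<Longrightarrow> card (verts G) = n \<Longrightarrow>
      (\<And>x. x \<in> verts G \<Longrightarrow> real (card {y \<in> verts G. {x, y} \<notin> edges G}) \<le> n powr (- ((1 + \<epsilon>) / k)) * n) \<Longrightarrow>
      T \<in> bounded_degree_trees n \<Delta> \<Longrightarrow> contains G T"
proof -
  define \<gamma> where "\<gamma> = \<epsilon> / 8"
  define K where "K = nat \<lceil>12 / \<gamma>\<rceil>"
  define c where "c = \<gamma> / (6 * (K + 1))"
  \<comment> \<open>The summands give \<open>C > 1\<close>, the bound on \<open>n / \<Delta>\<close>
    for many leaves, and \<open>14 * K * d < c\<close> for few leaves.\<close>
  define C where "C = 2 + 8 / \<epsilon> + 14 * K / c"
  have \<gamma>: "\<gamma> > 0" using \<epsilon> by (simp add: \<gamma>_def)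
  have K: "K \<ge> 12 / \<gamma>" by (simp add: K_def real_nat_ceiling_ge)
  have "12 / \<gamma> > 0" using \<gamma> by simp
  then have K1: "K \<ge> 1" using K by (cases K) auto
  have c: "c > 0" using \<gamma> by (simp add: c_def)
  have "8 / \<epsilon> > 0" "14 * K / c \<ge> 0" using \<epsilon> c by auto
  then have C: "C > 1" "C \<ge> 8 / \<epsilon>" "C > 14 * K / c" unfolding C_def by linarith+
  have "filterlim (\<lambda>n. c / 2 * real n / ln (real n)) at_top sequentially"
    using c by real_asymp
  then obtain N where N: "\<And>n. n \<ge> N \<Longrightarrow> K \<le> c / 2 * real n / ln (real n)"
    unfolding filterlim_at_top eventually_sequentially by blast
  show thesis
  proof (rule that[of C "max N 3"])
    fix n \<Delta> :: nat and k :: real and T and G :: "'b graph"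
    assume n: "n \<ge> max N 3" and k: "k > 0" "k * real \<Delta> \<le> n" and \<Delta>: "real \<Delta> \<ge> C * n / ln n"
      and G: "finite (verts G)" "card (verts G) = n"
      and D: "\<And>x. x \<in> verts G \<Longrightarrow> real (card {y \<in> verts G. {x, y} \<notin> edges G}) \<le> n powr (- ((1 + \<epsilon>) / k)) * n"
      and "T \<in> bounded_degree_trees n \<Delta>"
    then have T: "simple_graph T" "connected_graph T" "\<nexists>xs. graph_cycle T xs"
      and nT: "n = card (verts T)" and deg: "\<And>v. v \<in> verts T \<Longrightarrow> card (nbhd T v) \<le> \<Delta>"
      by (auto simp: bounded_degree_trees_def tree_graph_def degree_eq_card_nbhd)
    have n3: "n \<ge> 3" using n by simp
    then have lnn: "ln n > 0" by simp
    have "C * n / ln n > 0" using C lnn n3 by simp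
    then have \<Delta>0: "\<Delta> > 0" using \<Delta> by linarith
    have \<Delta>': "C * n \<le> \<Delta> * ln n" using \<Delta> lnn by (simp add: field_simps)
    define d where "d = exp (- ((1 + \<epsilon>) * ln n / k))"
    have dn: "n powr (- ((1 + \<epsilon>) / k)) = d" using n3 by (simp add: powr_def d_def)
    have "C * (k * \<Delta>) \<le> C * n" using k C by (intro mult_left_mono) auto
    \<comment> \<open>The bounds on \<Delta> force \<open>k \<le> ln n / C\<close>, so
      \<open>d \<le> exp (- C) < 1 / C\<close> is below any constant required.\<close>
    then have "C * k * \<Delta> \<le> ln n * \<Delta>" using \<Delta>' by (simp add: mult_ac)
    then have "C * k \<le> ln n" using \<Delta>0 by simp
    then have "C \<le> ln n / k" using k by (simp add: field_simps)
    also have "\<dots> \<le> (1 + \<epsilon>) * ln n / k" using k \<epsilon> lnn by (simp add: divide_right_mono)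
    finally have "d \<le> exp (- C)" by (simp add: d_def)
    moreover have "C < exp C" using exp_ge_add_one_self[of C] by linarith
    then have "exp (- C) < 1 / C" using C by (simp add: exp_minus field_simps)
    ultimately have dC: "d < 1 / C" by linarith
    then have dC': "d * C < 1" using C by (simp add: field_simps)
    have d0: "d > 0" by (simp add: d_def)
    have "d * (8 / \<epsilon>) \<le> d * C" using C d0 by (intro mult_left_mono) auto
    then have "d * (8 / \<epsilon>) \<le> 1" using dC' by linarith
    then have d1: "d \<le> \<epsilon> / 8" using \<epsilon> by (simp add: field_simps)
    have "d * (14 * K / c) \<le> d * C" using C d0 by (intro mult_left_mono) auto
    then have "d * (14 * K / c) < 1" using dC' by linarith
    then have d2: "14 * K * d < c" using c by (simp add: field_simps)
    have "8 / \<epsilon> * n \<le> C * n" using C by (intro mult_right_mono) auto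
    then have \<Delta>'': "8 / \<epsilon> * n \<le> \<Delta> * ln n" using \<Delta>' by linarith
    have cG: "card (verts G) = card (verts T)" using G nT by simp
    have D': "\<And>x. x \<in> verts G \<Longrightarrow> real (card {y \<in> verts G. {x, y} \<notin> edges G}) \<le> d * n"
      using D unfolding dn .
    have K12: "K + 1 \<ge> 12 / \<gamma>" using K by simp
    have Kn: "K \<le> c / 2 * n / ln n" using N n by simp
    show "contains G T"
    proof (cases "card {v \<in> verts T. card (nbhd T v) \<le> 1} \<ge> (1 - \<epsilon> / 8) * n")
      case True
      show ?thesis
        by (rule contains_if_many_leaves[OF T G(1) cG nT n3 deg D' \<epsilon> d_def d1 k \<Delta>0 \<Delta>'' True])
    next
      case False
      then have "card {v \<in> verts T. card (nbhd T v) \<le> 1} \<le> (1 - \<gamma>) * n" by (simp add: \<gamma>_def)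
      then show ?thesis
        using contains_if_few_leaves[OF T G(1) cG nT n3 D' \<gamma> K12 K1 c_def d0 d2 Kn] by blast
    qed
  qed (use C in auto)
qed

subsection \<open>Random graphs\<close>

lemma prob_Pi_pmf_bernoulli_all_False:
  assumes "finite A" "F \<subseteq> A" "0 \<le> p" "p \<le> 1"
  shows "measure_pmf.prob (Pi_pmf A False (\<lambda>_. bernoulli_pmf p)) {\<omega>. \<forall>e\<in>F. \<not> \<omega> e} = (1 - p) ^ card F"
proof -
  have "{\<omega>. \<forall>e\<in>F. \<not> \<omega> e} = Pi A (\<lambda>e. if e \<in> F then {False} else UNIV)"
    using assms(2) by (auto simp: Pi_def)
  then have "measure_pmf.prob (Pi_pmf A False (\<lambda>_. bernoulli_pmf p)) {\<omega>. \<forall>e\<in>F. \<not> \<omega> e}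
      = (\<Prod>e\<in>A. measure_pmf.prob (bernoulli_pmf p) (if e \<in> F then {False} else UNIV))"
    using assms(1) by (simp add: measure_Pi_pmf_Pi)
  also have "\<dots> = (\<Prod>e\<in>A. if e \<in> F then 1 - p else 1)"
    using assms by (intro prod.cong refl) (auto simp: measure_pmf_single)
  also have "\<dots> = (\<Prod>e\<in>F. 1 - p)"
    using assms(1,2) by (subst prod.inter_restrict[symmetric]) (auto simp: Int_absorb1)
  finally show ?thesis by simp
qed

text \<open>Union bound over a vertex \<open>x\<close> and a set \<open>Y\<close> of
  \<open>t\<close> other vertices, none adjacent to \<open>x\<close>.\<close>

lemma prob_random_graph_many_nonneighbours:
  assumes "0 \<le> p" "p \<le> 1"
  shows "measure_pmf.prob (random_graph n p)
      {G. \<not> (verts G = {..<n} \<and> (\<forall>x<n. card {y \<in> verts G. {x, y} \<notin> edges G} \<le> t))}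
    \<le> real n * (real (n choose t) * (1 - p) ^ t)"
proof -
  define A where "A = all_pairs {..<n}"
  define P where "P = Pi_pmf A False (\<lambda>_. bernoulli_pmf p)"
  define Ys where "Ys x = {Y. Y \<subseteq> {..<n} - {x} \<and> card Y = t}" for x
  define E where "E x Y = {\<omega> :: nat set \<Rightarrow> bool. \<forall>e \<in> (\<lambda>y. {x, y}) ` Y. \<not> \<omega> e}" for x Y
  have finA: "finite A"
    by (rule finite_subset[of _ "Pow {..<n}"]) (auto simp: A_def all_pairs_def)
  have finY: "finite (Ys x)" for x
    by (rule finite_subset[of _ "Pow {..<n}"]) (auto simp: Ys_def)
  have cY: "card (Ys x) \<le> n choose t" for x
  proof -
    have "card (Ys x) \<le> card {Y. Y \<subseteq> {..<n} \<and> card Y = t}"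
      by (rule card_mono) (auto simp: Ys_def)
    also have "\<dots> = n choose t" using n_subsets[of "{..<n}" t] by simp
    finally show ?thesis .
  qed
  have pE: "measure_pmf.prob P (E x Y) = (1 - p) ^ t" if x: "x < n" and Y: "Y \<in> Ys x" for x Y
  proof -
    have "(\<lambda>y. {x, y}) ` Y \<subseteq> A" using x Y by (auto simp: A_def Ys_def all_pairs_def card_insert_if)
    moreover have "card ((\<lambda>y. {x, y}) ` Y) = t"
      using Y by (subst card_image) (auto simp: Ys_def inj_on_def doubleton_eq_iff)
    ultimately show ?thesis
      unfolding P_def E_def by (simp only: prob_Pi_pmf_bernoulli_all_False[OF finA _ assms])
  qed
  let ?f = "\<lambda>\<omega>. ({..<n}, {e \<in> all_pairs {..<n}. \<omega> e})"
  let ?B = "{G. \<not> (verts G = {..<n} \<and> (\<forall>x<n. card {y \<in> verts G. {x, y} \<notin> edges G} \<le> t))}"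
  have sub: "?f -` ?B \<subseteq> (\<Union>x\<in>{..<n}. \<Union>Y\<in>Ys x. E x Y)"
  proof
    fix \<omega> assume "\<omega> \<in> ?f -` ?B"
    then obtain x where x: "x < n"
      and big: "t < card {y \<in> {..<n}. {x, y} \<notin> {e \<in> all_pairs {..<n}. \<omega> e}}" (is "t < card ?N")
      by (auto simp: not_le)
    \<comment> \<open>The count of non-neighbours includes \<open>x\<close>; exceeding
      \<open>t\<close> therefore still leaves \<open>t\<close> genuine ones.\<close>
    have "card ?N - card {x} \<le> card (?N - {x})" by (rule diff_card_le_card_Diff) simp
    moreover have "card {x} = 1" by simp
    ultimately have "t \<le> card (?N - {x})" using big by linarith
    then obtain Y where Y: "Y \<subseteq> ?N - {x}" "card Y = t" by (meson obtain_subset_with_card_n)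
    then have "Y \<in> Ys x" "\<omega> \<in> E x Y"
      using x by (auto simp: Ys_def E_def all_pairs_def card_2_iff)
    then show "\<omega> \<in> (\<Union>x\<in>{..<n}. \<Union>Y\<in>Ys x. E x Y)" using x by blast
  qed
  have "measure_pmf.prob (random_graph n p) ?B = measure_pmf.prob P (?f -` ?B)"
    by (simp add: random_graph_def P_def A_def)
  also have "\<dots> \<le> measure_pmf.prob P (\<Union>x\<in>{..<n}. \<Union>Y\<in>Ys x. E x Y)"
    by (rule measure_pmf.finite_measure_mono[OF sub]) simp
  also have "\<dots> \<le> (\<Sum>x<n. measure_pmf.prob P (\<Union>Y\<in>Ys x. E x Y))"
    by (rule measure_pmf.finite_measure_subadditive_finite) auto
  also have "\<dots> \<le> (\<Sum>x<n. \<Sum>Y\<in>Ys x. measure_pmf.prob P (E x Y))"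
    using finY by (intro sum_mono measure_pmf.finite_measure_subadditive_finite) auto
  also have "\<dots> = (\<Sum>x<n. card (Ys x) * (1 - p) ^ t)" using pE by simp
  also have "\<dots> \<le> (\<Sum>x<n. (n choose t) * (1 - p) ^ t)"
    using cY assms by (intro sum_mono mult_right_mono) auto
  finally show ?thesis by simp
qed

text \<open>The standard estimate of the binomial coefficient by the \<open>t\<close>-th power of
  \<open>exp 1 * n / t\<close>; it follows from \<open>t ^ t / fact t \<le> exp t\<close>, a single
  term of the exponential series.\<close>

lemma binomial_times_power_le:
  fixes q :: real
  assumes "q \<ge> 0" "t > 0"
  shows "real (n choose t) * q ^ t \<le> (exp 1 * (real n * q / real t)) ^ t"
proof -
  have "(real t ^ t /\<^sub>R fact t) \<le> exp (real t)"
    using sum_le_suminf[OF summable_exp_generic[of "real t"], of "{t}"] by (simp add: exp_def)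
  then have f: "real t ^ t \<le> exp (real t) * fact t" by (simp add: field_simps)
  have "real (n choose t) * fact t = real ((n choose t) * fact t)" by simp
  also have "\<dots> \<le> real (n ^ t)" using binomial_fact_pow by (subst of_nat_le_iff)
  finally have "real (n choose t) * fact t \<le> real n ^ t" by simp
  then have "real t ^ t * real (n choose t) \<le> exp (real t) * fact t * real (n choose t)"
    using f by (intro mult_right_mono) auto
  also have "\<dots> = exp (real t) * (real (n choose t) * fact t)" by simp
  also have "\<dots> \<le> exp (real t) * real n ^ t"
    using \<open>real (n choose t) * fact t \<le> real n ^ t\<close> by (intro mult_left_mono) auto
  finally have "real (n choose t) \<le> exp (real t) * real n ^ t / real t ^ t"
    using assms(2) by (simp add: field_simps)
  then have "real (n choose t) * q ^ t \<le> exp (real t) * real n ^ t / real t ^ t * q ^ t"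
    using assms(1) by (intro mult_right_mono) auto
  also have "\<dots> = (exp 1 * (real n * q / real t)) ^ t"
    by (simp add: power_mult_distrib power_divide exp_of_nat_mult[symmetric])
  finally show ?thesis .
qed

text \<open>The exponents of \<open>q\<close> and \<open>d\<close> differ by at least
  \<open>\<eta> / k\<close>, and \<open>k \<le> \<eta> / 3 * ln n\<close>, so
  \<open>q / d \<le> exp (- 3)\<close>. The base \<open>exp 1 * n * q / t\<close> is then at most
  \<open>exp (- 1)\<close>.\<close>

lemma nonneighbour_tail:
  fixes \<epsilon> \<eta> k q d :: real and n :: nat
  assumes \<eta>: "0 < \<eta>" "\<eta> \<le> \<epsilon>" "\<eta> \<le> 1 / 2" and n: "n \<ge> 3" and k: "k \<ge> 2" "3 / \<eta> * k \<le> ln n"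
    and q: "q = n powr (- ((1 + 2 * \<epsilon>) / k))" and d: "d = n powr (- ((1 + \<eta>) / k))"
  shows "real n * (real (n choose nat \<lfloor>d * n\<rfloor>) * q ^ nat \<lfloor>d * n\<rfloor>) \<le> real n * exp (- (real n powr (1 / 4) / 2))"
proof (rule mult_left_mono)
  define t where "t = nat \<lfloor>d * n\<rfloor>"
  have q0: "q > 0" and d0: "d > 0" using n by (auto simp: q d)
  \<comment> \<open>The exponent is at most 3/4 because \<open>\<eta> \<le> 1 / 2\<close> and
    \<open>k \<ge> 2\<close>; this makes the threshold at least
    \<open>n powr (1 / 4)\<close>.\<close>
  have "(1 + \<eta>) / k \<le> (1 + 1 / 2) / 2" using \<eta> k by (intro frac_le) auto
  then have "n powr (1 / 4) \<le> n powr (1 - (1 + \<eta>) / k)" using n by (intro powr_mono) auto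
  also have "\<dots> = d * n" using n by (simp add: d powr_diff powr_minus field_simps)
  finally have dn: "n powr (1 / 4) \<le> d * n" .
  moreover have "n powr (1 / 4) \<ge> 1" using n by (simp add: ge_one_powr_ge_zero)
  ultimately have dn1: "d * n \<ge> 1" by linarith
  then have "\<lfloor>d * n\<rfloor> \<ge> 1" by (simp add: le_floor_iff)
  then have "real t = \<lfloor>d * n\<rfloor>" by (simp add: t_def)
  then have t: "real t \<ge> d * n / 2" "t > 0" using dn1 \<open>\<lfloor>d * n\<rfloor> \<ge> 1\<close> by linarith+
  have "q / d = n powr (- ((1 + 2 * \<epsilon>) / k) + (1 + \<eta>) / k)"
    unfolding powr_add q d by (simp add: powr_minus_divide)
  also have "- ((1 + 2 * \<epsilon>) / k) + (1 + \<eta>) / k = - ((2 * \<epsilon> - \<eta>) / k)"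
    by (simp add: diff_divide_distrib add_divide_distrib)
  also have "n powr \<dots> \<le> n powr (- (\<eta> / k))"
    using n \<eta> k by (intro powr_mono) (auto intro!: divide_right_mono)
  also have "\<dots> = exp (- (\<eta> * ln n / k))" using n by (simp add: powr_def)
  also have "\<dots> \<le> exp (- 3)"
  proof -
    have "\<eta> * (3 / \<eta> * k) \<le> \<eta> * ln n" using k \<eta> by (intro mult_left_mono) auto
    then have "3 * k \<le> \<eta> * ln n" using \<eta> by simp
    then show ?thesis using k by (simp add: pos_le_divide_eq)
  qed
  finally have qd: "q / d \<le> exp (- 3)" .
  have "n * q / t \<le> n * q / (d * n / 2)"
    using t d0 q0 n by (intro divide_left_mono) auto
  also have "\<dots> = 2 * (q / d)" using n d0 by simp
  also have "\<dots> \<le> exp 1 * exp (- 3)"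
    using qd q0 d0 exp_ge_add_one_self[of 1] by (intro mult_mono) auto
  finally have "exp 1 * (n * q / t) \<le> exp 1 * (exp 1 * exp (- 3))" by (intro mult_left_mono) auto
  also have "\<dots> = exp (- 1 :: real)" by (simp add: exp_add[symmetric])
  finally have "(exp 1 * (n * q / t)) ^ t \<le> exp (- 1) ^ t"
    using q0 by (intro power_mono) auto
  then have "real (n choose t) * q ^ t \<le> exp (- 1) ^ t"
    using q0 t(2) by (intro order_trans[OF binomial_times_power_le[of q t n]]) auto
  also have "\<dots> = exp (- real t)" by (simp add: exp_of_nat_mult[symmetric])
  also have "\<dots> \<le> exp (- (real n powr (1 / 4) / 2))" using t dn by simp
  finally show "real (n choose nat \<lfloor>d * n\<rfloor>) * q ^ nat \<lfloor>d * n\<rfloor> \<le> exp (- (real n powr (1 / 4) / 2))"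
    unfolding t_def .
qed simp

section \<open>Combining the deterministic and the probabilistic part\<close>

theorem corollary1p2:
  fixes \<epsilon> :: real
  assumes "\<epsilon> > 0"
  shows "\<exists>C::real. C > 1 \<and>
    (\<forall>(\<Delta> :: nat \<Rightarrow> nat) (k :: nat \<Rightarrow> int).
      (\<forall>\<^sub>F n in sequentially.
         real (\<Delta> n) \<ge> C * real n / ln (real n) \<and>
         k n = \<lceil>(real n - 1) / real (\<Delta> n)\<rceil> - 1 \<and>
         k n \<ge> 2) \<longrightarrow>
      (\<lambda>n. measure_pmf.prob
              (random_graph n (1 - real n powr (- ((1 + 2 * \<epsilon>) / real_of_int (k n)))))
              {G. \<forall>T \<in> bounded_degree_trees n (\<Delta> n). contains G T})
        \<longlonglongrightarrow> 1)"
proof -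
  define \<eta> where "\<eta> = min \<epsilon> (1 / 2)"
  have \<eta>: "0 < \<eta>" "\<eta> \<le> \<epsilon>" "\<eta> \<le> 1 / 2" "\<eta> \<le> 1" using assms by (auto simp: \<eta>_def)
  obtain C N where C: "C > 1" and N: "N \<ge> 3"
    and emb: "\<And>n \<Delta> k T (G :: nat graph). n \<ge> N \<Longrightarrow> k > 0 \<Longrightarrow> k * real \<Delta> \<le> n \<Longrightarrow>
      real \<Delta> \<ge> C * n / ln n \<Longrightarrow> finite (verts G) \<Longrightarrow> card (verts G) = n \<Longrightarrow>
      (\<And>x. x \<in> verts G \<Longrightarrow> real (card {y \<in> verts G. {x, y} \<notin> edges G}) \<le> n powr (- ((1 + \<eta>) / k)) * n) \<Longrightarrow>
      T \<in> bounded_degree_trees n \<Delta> \<Longrightarrow> contains G T"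
    using dense_graph_contains_trees[OF \<eta>(1,4)] by blast
  \<comment> \<open>The bound \<open>C' * k \<le> ln n\<close> derived below then yields the
    \<open>3 / \<eta> * k \<le> ln n\<close> of the tail estimate.\<close>
  define C' where "C' = max C (3 / \<eta>)"
  have C': "C' > 1" "C' \<ge> C" "C' \<ge> 3 / \<eta>" using C by (auto simp: C'_def)
  show ?thesis
  proof (intro exI[of _ C'] conjI allI impI)
    fix \<Delta> :: "nat \<Rightarrow> nat" and k :: "nat \<Rightarrow> int"
    let ?p = "\<lambda>n. 1 - real n powr (- ((1 + 2 * \<epsilon>) / real_of_int (k n)))"
    let ?P = "\<lambda>n. measure_pmf.prob (random_graph n (?p n)) {G. \<forall>T \<in> bounded_degree_trees n (\<Delta> n). contains G T}"
    assume hyp: "\<forall>\<^sub>F n in sequentially. real (\<Delta> n) \<ge> C' * real n / ln (real n) \<and>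
         k n = \<lceil>(real n - 1) / real (\<Delta> n)\<rceil> - 1 \<and> k n \<ge> 2"
    \<comment> \<open>The lower bound depends on \<open>n\<close> alone, so \<Delta> and
      \<open>k\<close> may vary with \<open>n\<close>.\<close>
    have lower: "1 - real n * exp (- (real n powr (1 / 4) / 2)) \<le> ?P n"
      if n: "n \<ge> N" and \<Delta>: "real (\<Delta> n) \<ge> C' * real n / ln (real n)"
        and k: "k n = \<lceil>(real n - 1) / real (\<Delta> n)\<rceil> - 1" "k n \<ge> 2" for n
    proof -
      define r where "r = real_of_int (k n)"
      define d where "d = n powr (- ((1 + \<eta>) / r))"
      define t where "t = nat \<lfloor>d * n\<rfloor>"
      have n3: "n \<ge> 3" using n N by simp
      then have lnn: "ln (real n) > 0" by simp
      have r: "r \<ge> 2" using k by (simp add: r_def)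
      have "C' * n / ln n > 0" using C' lnn n3 by simp
      then have \<Delta>0: "real (\<Delta> n) > 0" using \<Delta> by linarith
      \<comment> \<open>A ceiling minus one is strictly below its argument.\<close>
      have "r < (real n - 1) / real (\<Delta> n)"
        unfolding r_def using k(1) by linarith
      then have r\<Delta>: "r * \<Delta> n \<le> n" using \<Delta>0 by (simp add: pos_less_divide_eq)
      have "C' * (r * \<Delta> n) \<le> C' * n" using r\<Delta> C' by (intro mult_left_mono) auto
      also have "\<dots> \<le> ln n * \<Delta> n" using \<Delta> lnn by (simp add: pos_divide_le_eq mult.commute)
      finally have "C' * r \<le> ln n" using \<Delta>0 by (simp add: mult.assoc[symmetric])
      moreover have "3 / \<eta> * r \<le> C' * r" using C' r by (intro mult_right_mono) auto
      ultimately have Cr: "3 / \<eta> * r \<le> ln n" by linarith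
      have "C * n / ln n \<le> C' * n / ln n" using C' lnn by (intro divide_right_mono mult_right_mono) auto
      then have \<Delta>C: "real (\<Delta> n) \<ge> C * n / ln n" using \<Delta> by linarith
      have p: "0 \<le> ?p n" "?p n \<le> 1"
        using n3 r assms by (auto simp: powr_minus r_def[symmetric] inverse_le_1_iff ge_one_powr_ge_zero)
      let ?B = "{G. \<not> (verts G = {..<n} \<and> (\<forall>x<n. card {y \<in> verts G. {x, y} \<notin> edges G} \<le> t))}"
      have "contains G T" if G: "G \<notin> ?B" and T: "T \<in> bounded_degree_trees n (\<Delta> n)" for G T
      proof (rule emb[OF n _ r\<Delta> \<Delta>C _ _ _ T])
        fix x assume "x \<in> verts G"
        then have "card {y \<in> verts G. {x, y} \<notin> edges G} \<le> t" using G by auto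
        then have "real (card {y \<in> verts G. {x, y} \<notin> edges G}) \<le> real t" by simp
        also have "\<dots> \<le> d * n" by (simp add: t_def d_def)
        finally show "real (card {y \<in> verts G. {x, y} \<notin> edges G}) \<le> n powr (- ((1 + \<eta>) / r)) * n"
          unfolding d_def .
      qed (use r G in auto)
      then have "- ?B \<subseteq> {G. \<forall>T \<in> bounded_degree_trees n (\<Delta> n). contains G T}" by blast
      then have "measure_pmf.prob (random_graph n (?p n)) (- ?B) \<le> ?P n"
        by (rule measure_pmf.finite_measure_mono) simp
      moreover have "measure_pmf.prob (random_graph n (?p n)) (- ?B)
          = 1 - measure_pmf.prob (random_graph n (?p n)) ?B"
        using measure_pmf.prob_compl[of ?B "random_graph n (?p n)"] by (simp add: Compl_eq_Diff_UNIV)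
      moreover have "measure_pmf.prob (random_graph n (?p n)) ?B
          \<le> real n * exp (- (real n powr (1 / 4) / 2))"
        using prob_random_graph_many_nonneighbours[OF p, of n t]
          nonneighbour_tail[OF \<eta>(1-3) n3 r Cr refl d_def]
        by (simp add: t_def r_def)
      ultimately show ?thesis by linarith
    qed
    show "?P \<longlonglongrightarrow> 1"
    proof (rule tendsto_sandwich[where h = "\<lambda>_. 1"])
      show "(\<lambda>n. 1 - real n * exp (- (real n powr (1 / 4) / 2))) \<longlonglongrightarrow> 1" by real_asymp
      show "\<forall>\<^sub>F n in sequentially. 1 - real n * exp (- (real n powr (1 / 4) / 2)) \<le> ?P n"
        using hyp eventually_ge_at_top[of N] by eventually_elim (use lower in blast)
    qed (auto intro: always_eventually)
  qed (use C' in auto)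
qed

end
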